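(* Let $H$ be a finite two-step nilpotent $p$-group ($p$ prime) whose commutator subgroup $[H,H]$ is cyclic. Then \[ m_{\mathsf{faithful}}(H)=\sqrt{[H:Z(H)]}+m_{\mathsf{faithful}}(Z(H))-1, \] where $Z(H)$ is the center of $H$.
   Context: For a finite group $G$, $m_{\mathsf{faithful}}(G)$ denotes the smallest dimension of a faithful complex representation of $G$. *)

theory Defs
  imports "HOL-Algebra.Algebra" "Jordan_Normal_Form.Matrix"
begin

definition group_center :: "('a, 'b) monoid_scheme \<Rightarrow> 'a set" where
  "group_center G = {z \<in> carrier G. \<forall>g \<in> carrier G. z \<otimes>\<^bsub>G\<^esub> g = g \<otimes>\<^bsub>G\<^esub> z}"

definition faithful_rep :: "('a, 'b) monoid_scheme \<Rightarrow> nat \<Rightarrow> ('a \<Rightarrow> complex mat) \<Rightarrow> bool" where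
  "faithful_rep G n \<rho> \<longleftrightarrow>
     (\<forall>x \<in> carrier G. \<rho> x \<in> carrier_mat n n) \<and>
     (\<forall>x \<in> carrier G. \<forall>y \<in> carrier G. \<rho> (x \<otimes>\<^bsub>G\<^esub> y) = \<rho> x * \<rho> y) \<and>
     \<rho> \<one>\<^bsub>G\<^esub> = 1\<^sub>m n \<and>
     inj_on \<rho> (carrier G)"

definition m_faithful :: "('a, 'b) monoid_scheme \<Rightarrow> nat" where
  "m_faithful G = (LEAST n. \<exists>\<rho>. faithful_rep G n \<rho>)"

end

theory Submission
  imports Defs
begin

text \<open>
  Let \<open>D\<close> be the commutator subgroup, \<open>Z\<close> the centre and \<open>A\<close> a maximal set of pairwise commuting
  elements; \<open>A\<close> is a subgroup that contains \<open>Z\<close> and is its own centralizer. Assume \<open>D\<close> nontrivial.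
  As \<open>D\<close> is a cyclic p-group, a character is injective on \<open>D\<close> as soon as it is nontrivial at one
  fixed element of order p, so every faithful representation has a weight with this property.
  For a character \<open>\<chi>\<close> injective on \<open>D\<close>, the pairing \<open>\<chi> [g, h]\<close> is nondegenerate modulo \<open>Z\<close>, and
  counting characters gives \<open>[G:A] = [A:Z]\<close>; so \<open>d = [G:A]\<close> is the square root of \<open>[G:Z]\<close>.

  Lower bound: the dimension is at least the number of weights of \<open>A\<close>. A weight injective on \<open>D\<close> has
  \<open>d\<close> distinct conjugates, all with the same restriction to \<open>Z\<close>. The restrictions of all weights
  to \<open>Z\<close> have trivial common kernel, so there are at least \<open>m_faithful Z\<close> of them.

  Upper bound: the weights of a minimal faithful representation of \<open>Z\<close> include some \<open>\<chi>0\<close> injective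
  on \<open>D\<close>. Multiplying the others by powers of \<open>\<chi>0\<close> makes them trivial on \<open>D\<close>, so that they extend
  to \<open>G\<close>; add to these the representation induced from an extension of \<open>\<chi>0\<close> to \<open>A\<close>. The sum
  is faithful on \<open>Z\<close>, hence on \<open>G\<close>, since a nontrivial normal subgroup meets \<open>Z\<close>.
\<close>

section \<open>Functions on a set as a complex vector space\<close>

text \<open>Operators act on all complex functions; subspaces enter separately as sets. In this way
  matrices and translations fall under the same notion.\<close>

definition linear_op :: "(('x \<Rightarrow> complex) \<Rightarrow> 'x \<Rightarrow> complex) \<Rightarrow> bool" where
  "linear_op T \<longleftrightarrow> (\<forall>a u v. T (\<lambda>x. a * u x + v x) = (\<lambda>x. a * T u x + T v x))"

lemma linear_op_add_scale:
  "linear_op T \<Longrightarrow> T (\<lambda>x. a * u x + v x) = (\<lambda>x. a * T u x + T v x)"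
  by (simp add: linear_op_def)

lemma linear_op_zero:
  assumes "linear_op T"
  shows "T (\<lambda>x. 0) = (\<lambda>x. 0)"
proof -
  have "T (\<lambda>x. 0) = (\<lambda>x. T (\<lambda>x. 0) x + T (\<lambda>x. 0) x)"
    using linear_op_add_scale[OF assms, of 1 "\<lambda>x. 0" "\<lambda>x. 0"] by simp
  then show ?thesis
    by (metis add_cancel_right_left)
qed

lemma linear_op_scale:
  "linear_op T \<Longrightarrow> T (\<lambda>x. a * u x) = (\<lambda>x. a * T u x)"
  using linear_op_add_scale[of T a u "\<lambda>x. 0"] by (simp add: linear_op_zero)

lemma linear_op_sum:
  assumes "linear_op T" "finite I"
  shows "T (\<lambda>x. \<Sum>i\<in>I. c i * F i x) = (\<lambda>x. \<Sum>i\<in>I. c i * T (F i) x)"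
  using assms(2)
proof (induction I rule: finite_induct)
  case empty
  then show ?case by (simp add: linear_op_zero[OF assms(1)])
next
  case (insert i I)
  then show ?case
    using linear_op_add_scale[OF assms(1), of "c i" "F i" "\<lambda>x. \<Sum>i\<in>I. c i * F i x"] by simp
qed

text \<open>Induction on \<open>S\<close>: to the relation one applies \<open>T g\<close>, for a
  \<open>g\<close> that separates \<open>s\<close> from the new index \<open>t\<close>, and
  subtracts \<open>\<mu> t g\<close> times the relation. The term of \<open>t\<close> disappears,
  and the coefficient of \<open>s\<close> is multiplied by a nonzero number.\<close>

lemma independent_eigenfunctions:
  fixes f :: "'s \<Rightarrow> 'x \<Rightarrow> complex"
  assumes "finite S"
    and lin: "\<And>g. g \<in> K \<Longrightarrow> linear_op (T g)"
    and eig: "\<And>g s. g \<in> K \<Longrightarrow> s \<in> S \<Longrightarrow> T g (f s) = (\<lambda>x. \<mu> s g * f s x)"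
    and nz: "\<And>s. s \<in> S \<Longrightarrow> f s \<noteq> (\<lambda>x. 0)"
    and dist: "\<And>s t. s \<in> S \<Longrightarrow> t \<in> S \<Longrightarrow> s \<noteq> t \<Longrightarrow> \<exists>g\<in>K. \<mu> s g \<noteq> \<mu> t g"
    and "(\<lambda>x. \<Sum>s\<in>S. c s * f s x) = (\<lambda>x. 0)"
  shows "\<forall>s\<in>S. c s = 0"
  using assms(1) eig nz dist assms(6)
proof (induction S arbitrary: c rule: finite_induct)
  case empty
  then show ?case by simp
next
  case (insert t S)
  have "c s = 0" if s: "s \<in> S" for s
  proof -
    obtain g where g: "g \<in> K" "\<mu> s g \<noteq> \<mu> t g"
      using insert.prems(3)[of s t] insert.hyps s by blast
    have rel: "c t * f t x + (\<Sum>s\<in>S. c s * f s x) = 0" for x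
      using insert.hyps insert.prems(4) by (simp add: fun_eq_iff)
    have "(\<lambda>x. \<Sum>s\<in>insert t S. c s * T g (f s) x) = (\<lambda>x. 0)"
      using linear_op_sum[OF lin[OF g(1)], of "insert t S" c f] insert.hyps insert.prems(4)
        linear_op_zero[OF lin[OF g(1)]] by simp
    then have "(\<Sum>s\<in>insert t S. c s * T g (f s) x) = 0" for x
      by meson
    moreover have "(\<Sum>s\<in>insert t S. c s * T g (f s) x)
        = c t * (\<mu> t g * f t x) + (\<Sum>s\<in>S. c s * (\<mu> s g * f s x))" for x
      using insert.hyps insert.prems(1)[OF g(1)] by simp
    ultimately have relg: "c t * (\<mu> t g * f t x) + (\<Sum>s\<in>S. c s * (\<mu> s g * f s x)) = 0" for x
      by simp
    have "(\<Sum>s\<in>S. c s * (\<mu> s g - \<mu> t g) * f s x) = 0" for x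
    proof -
      have "(\<Sum>s\<in>S. c s * (\<mu> s g - \<mu> t g) * f s x)
          = (\<Sum>s\<in>S. c s * (\<mu> s g * f s x)) - \<mu> t g * (\<Sum>s\<in>S. c s * f s x)"
        by (simp add: sum_distrib_left sum_subtractf algebra_simps)
      also have "\<dots> = (c t * (\<mu> t g * f t x) + (\<Sum>s\<in>S. c s * (\<mu> s g * f s x)))
          - \<mu> t g * (c t * f t x + (\<Sum>s\<in>S. c s * f s x))"
        by (simp add: algebra_simps)
      finally show ?thesis using rel relg by simp
    qed
    then have "\<forall>s\<in>S. c s * (\<mu> s g - \<mu> t g) = 0"
      by (intro insert.IH) (use insert.prems in auto)
    then show ?thesis using s g(2) by auto
  qed
  moreover have "c t = 0"
  proof -
    obtain x where "f t x \<noteq> 0"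
      using insert.prems(2)[of t] by auto
    moreover have "c t * f t x = 0"
      using fun_cong[OF insert.prems(4), of x] insert.hyps \<open>\<And>s. s \<in> S \<Longrightarrow> c s = 0\<close> by simp
    ultimately show ?thesis by simp
  qed
  ultimately show ?case by simp
qed

text \<open>Gaussian elimination: \<open>Y\<close> indexes homogeneous equations, \<open>S\<close>
  the unknowns. Each equation is either void or used to eliminate one unknown.\<close>

lemma nontrivial_relation:
  fixes f :: "'s \<Rightarrow> 'x \<Rightarrow> complex"
  assumes "finite Y" "finite S" "card Y < card S"
  shows "\<exists>c. (\<exists>s\<in>S. c s \<noteq> 0) \<and> (\<forall>x\<in>Y. (\<Sum>s\<in>S. c s * f s x) = 0)"
  using assms
proof (induction Y arbitrary: S f rule: finite_induct)
  case empty
  then have "S \<noteq> {}" by auto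
  then show ?case by (intro exI[of _ "\<lambda>_. 1"]) auto
next
  case (insert x Y)
  show ?case
  proof (cases "\<forall>s\<in>S. f s x = 0")
    case True
    obtain c where "\<exists>s\<in>S. c s \<noteq> 0" "\<forall>x\<in>Y. (\<Sum>s\<in>S. c s * f s x) = 0"
      using insert.IH[of S f] insert.prems insert.hyps by auto
    with True show ?thesis by (intro exI[of _ c]) auto
  next
    case False
    then obtain t where t: "t \<in> S" "f t x \<noteq> 0" by auto
    define S' where "S' = S - {t}"
    have S: "S = insert t S'" "t \<notin> S'" "finite S'"
      using t insert.prems by (auto simp: S'_def)
    have "card Y < card S'"
      using insert.prems insert.hyps S by simp
    then obtain c where c: "\<exists>s\<in>S'. c s \<noteq> 0"
      "\<forall>y\<in>Y. (\<Sum>s\<in>S'. c s * (f s y - f s x / f t x * f t y)) = 0"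
      using insert.IH[of S' "\<lambda>s y. f s y - f s x / f t x * f t y"] S by blast
    \<comment> \<open>The value at \<open>t\<close> is the one that solves the equation at
      \<open>x\<close>.\<close>
    define c' where "c' = (\<lambda>s. if s = t then - (\<Sum>s\<in>S'. c s * (f s x / f t x)) else c s)"
    have eq: "(\<Sum>s\<in>S. c' s * f s y) = (\<Sum>s\<in>S'. c s * (f s y - f s x / f t x * f t y))" for y
    proof -
      have "(\<Sum>s\<in>S'. c' s * f s y) = (\<Sum>s\<in>S'. c s * f s y)"
        by (intro sum.cong) (use S(2) in \<open>auto simp: c'_def\<close>)
      then show ?thesis
        using S by (simp add: c'_def algebra_simps sum_subtractf sum_distrib_left sum_distrib_right)
    qed
    have "(\<Sum>s\<in>S. c' s * f s y) = 0" if "y \<in> insert x Y" for y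
      using that c(2) t(2) unfolding eq by auto
    moreover have "\<exists>s\<in>S. c' s \<noteq> 0"
      using c(1) S by (auto simp: c'_def)
    ultimately show ?thesis by blast
  qed
qed

lemma card_independent_le:
  fixes f :: "'s \<Rightarrow> 'x \<Rightarrow> complex"
  assumes "finite Y" "finite S"
    and "\<And>c. (\<forall>x\<in>Y. (\<Sum>s\<in>S. c s * f s x) = 0) \<Longrightarrow> \<forall>s\<in>S. c s = 0"
  shows "card S \<le> card Y"
  using nontrivial_relation[OF assms(1,2), of f] assms(3) by (metis not_le)

section \<open>Linear characters\<close>

text \<open>Conditions are imposed on \<open>A\<close> only, so one function serves as a character
  of \<open>A\<close> and of every smaller subgroup. On a subgroup, values are nonzero because
  \<open>\<one>\<close> has value 1.\<close>

definition lin_char :: "('a, 'b) monoid_scheme \<Rightarrow> 'a set \<Rightarrow> ('a \<Rightarrow> complex) \<Rightarrow> bool" where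
  "lin_char G A \<chi> \<longleftrightarrow> \<chi> \<one>\<^bsub>G\<^esub> = 1 \<and> (\<forall>x\<in>A. \<forall>y\<in>A. \<chi> (x \<otimes>\<^bsub>G\<^esub> y) = \<chi> x * \<chi> y)"

lemma lin_char_one: "lin_char G A \<chi> \<Longrightarrow> \<chi> \<one>\<^bsub>G\<^esub> = 1"
  by (simp add: lin_char_def)

lemma lin_char_mult: "lin_char G A \<chi> \<Longrightarrow> x \<in> A \<Longrightarrow> y \<in> A \<Longrightarrow> \<chi> (x \<otimes>\<^bsub>G\<^esub> y) = \<chi> x * \<chi> y"
  by (simp add: lin_char_def)

lemma lin_char_subset: "lin_char G A \<chi> \<Longrightarrow> B \<subseteq> A \<Longrightarrow> lin_char G B \<chi>"
  by (auto simp: lin_char_def)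

context group
begin

lemma subgroup_nat_pow_closed:
  "subgroup A G \<Longrightarrow> a \<in> A \<Longrightarrow> a [^] (n::nat) \<in> A"
  by (induction n) (auto simp: subgroup.one_closed subgroup.m_closed)

lemma lin_char_nonzero:
  assumes "lin_char G A \<chi>" "subgroup A G" "x \<in> A"
  shows "\<chi> x \<noteq> 0"
proof -
  have "\<chi> x * \<chi> (inv x) = \<chi> (x \<otimes> inv x)"
    using lin_char_mult[OF assms(1,3)] assms(2,3) by (simp add: subgroup.m_inv_closed)
  also have "\<dots> = 1"
    using lin_char_one[OF assms(1)] subgroup.mem_carrier[OF assms(2,3)] by simp
  finally show ?thesis by auto
qed

lemma lin_char_pow:
  assumes "lin_char G A \<chi>" "subgroup A G" "x \<in> A"
  shows "\<chi> (x [^] (n::nat)) = \<chi> x ^ n"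
  by (induction n)
    (use assms in \<open>simp_all add: lin_char_one lin_char_mult subgroup_nat_pow_closed\<close>)

end

section \<open>Simultaneous eigenvectors of a commuting finite group action\<close>

locale commuting_action = group G for G (structure) +
  fixes A :: "'a set" and W :: "('x \<Rightarrow> complex) set"
    and T :: "'a \<Rightarrow> ('x \<Rightarrow> complex) \<Rightarrow> 'x \<Rightarrow> complex"
  assumes fin: "finite (carrier G)" and A: "subgroup A G"
    and lin: "\<And>a. a \<in> A \<Longrightarrow> linear_op (T a)"
    and W: "\<And>a u v. u \<in> W \<Longrightarrow> v \<in> W \<Longrightarrow> (\<lambda>x. a * u x + v x) \<in> W"
    and invariant: "\<And>a w. a \<in> A \<Longrightarrow> w \<in> W \<Longrightarrow> T a w \<in> W"
    and mult: "\<And>a b w. a \<in> A \<Longrightarrow> b \<in> A \<Longrightarrow> w \<in> W \<Longrightarrow> T (a \<otimes> b) w = T a (T b w)"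
    and one: "\<And>w. w \<in> W \<Longrightarrow> T \<one> w = w"
    and comm: "\<And>a b w. a \<in> A \<Longrightarrow> b \<in> A \<Longrightarrow> w \<in> W \<Longrightarrow> T a (T b w) = T b (T a w)"
begin

text \<open>For each root of unity \<zeta> of order dividing \<open>N\<close>, the sum of
  \<open>\<zeta> ^ i\<close> times \<open>b [^] i\<close> applied to \<open>w\<close> is zero or an
  eigenvector of \<open>b\<close>. These sums add up to \<open>N\<close> times \<open>w\<close>, so
  one of them is nonzero. As they are combinations of the vectors \<open>T (b [^] i) w\<close>, they
  keep every eigenvalue that \<open>w\<close> already has.\<close>

lemma eigenvector_of_finite_order:
  assumes w: "w \<in> W" "w \<noteq> (\<lambda>x. 0)" and b: "b \<in> A"
  shows "\<exists>u\<in>W. u \<noteq> (\<lambda>x. 0) \<and> (\<exists>\<mu>. T b u = (\<lambda>x. \<mu> * u x)) \<and>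
    (\<forall>a\<in>A. \<forall>\<nu>. T a w = (\<lambda>x. \<nu> * w x) \<longrightarrow> T a u = (\<lambda>x. \<nu> * u x))"
proof -
  define N where "N = order G"
  have N: "N > 0" "b [^] N = \<one>"
    using fin b subgroup.mem_carrier[OF A] by (auto simp: N_def order_gt_0_iff_finite pow_order_eq_1)
  have bA: "b [^] i \<in> A" for i :: nat
    using subgroup_nat_pow_closed[OF A b] .
  define \<zeta> where "\<zeta> = (\<lambda>j. cis (2 * pi * real j / real N))"
  have roots: "bij_betw \<zeta> {..<N} {z. z ^ N = 1}"
    unfolding \<zeta>_def using bij_betw_roots_unity[OF N(1)] .
  define u where "u = (\<lambda>j x. \<Sum>i<N. \<zeta> j ^ i * T (b [^] i) w x)"
  \<comment> \<open>\<open>W\<close> is closed under \<open>a * u + v\<close>; the coefficient -1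
    applied to \<open>w\<close> and \<open>w\<close> gives zero.\<close>
  have zW: "(\<lambda>x. 0) \<in> W"
    using W[OF w(1) w(1), of "-1"] by simp
  have sumW: "(\<lambda>x. \<Sum>i\<in>I. c i * F i x) \<in> W" if "finite I" "\<And>i. i \<in> I \<Longrightarrow> F i \<in> W"
    for I :: "nat set" and c F
    using that
  proof (induction I rule: finite_induct)
    case empty
    then show ?case using zW by simp
  next
    case (insert i I)
    then show ?case using W[of "F i" "\<lambda>x. \<Sum>i\<in>I. c i * F i x" "c i"] by simp
  qed
  have uW: "u j \<in> W" for j
    unfolding u_def by (intro sumW invariant bA w) auto
  have eig: "T b (u j) = (\<lambda>x. inverse (\<zeta> j) * u j x)" if j: "j < N" for j
  proof -
    have z: "\<zeta> j ^ N = 1" "\<zeta> j \<noteq> 0"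
      using roots j by (auto simp: bij_betw_def \<zeta>_def)
    have Tb: "T b (u j) x = (\<Sum>i<N. \<zeta> j ^ i * T (b [^] Suc i) w x)" for x
    proof -
      have "T b (T (b [^] i) w) = T (b [^] Suc i) w" for i :: nat
        using mult[OF b bA w(1)] nat_pow_Suc2[OF subgroup.mem_carrier[OF A b]] by simp
      then show ?thesis
        unfolding u_def by (subst linear_op_sum[OF lin[OF b]]) auto
    qed
    have "\<zeta> j * T b (u j) x = u j x" for x
    proof -
      define h where "h = (\<lambda>i. \<zeta> j ^ i * T (b [^] (i::nat)) w x)"
      have "\<zeta> j * T b (u j) x = (\<Sum>i<N. h (Suc i))"
        unfolding Tb h_def by (simp add: sum_distrib_left mult.assoc)
      also have "\<dots> = (\<Sum>i<Suc N. h i) - h 0"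
        by (subst sum.lessThan_Suc_shift) simp
      also have "\<dots> = (\<Sum>i<N. h i) + h N - h 0" by simp
      \<comment> \<open>Multiplying by \<open>\<zeta> j\<close> and applying \<open>b\<close> shifts
        the sum cyclically.\<close>
      also have "h N = h 0"
        using z N(2) by (simp add: h_def)
      finally show ?thesis by (simp add: h_def u_def)
    qed
    then show ?thesis using z(2) by (auto simp: fun_eq_iff field_simps)
  qed
  have other: "T a (u j) = (\<lambda>x. \<nu> * u j x)" if a: "a \<in> A" "T a w = (\<lambda>x. \<nu> * w x)" for a \<nu> j
  proof -
    have "T a (T (b [^] i) w) = (\<lambda>x. \<nu> * T (b [^] i) w x)" for i :: nat
      using comm[OF a(1) bA w(1)] a(2) linear_op_scale[OF lin[OF bA]] by simp
    then show ?thesis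
      unfolding u_def
      by (subst linear_op_sum[OF lin[OF a(1)]]) (auto simp: sum_distrib_left mult_ac)
  qed
  have "\<exists>j<N. u j \<noteq> (\<lambda>x. 0)"
  proof (rule ccontr)
    assume "\<not> ?thesis"
    then have z: "u j x = 0" if "j < N" for j x
      using that by (metis (mono_tags))
    obtain x where x: "w x \<noteq> 0" using w(2) by auto
    have zz: "\<zeta> j ^ i = \<zeta> i ^ j" for i j
      by (simp add: \<zeta>_def DeMoivre mult_ac)
    \<comment> \<open>Orthogonality: summed over all roots of unity, only the term
      \<open>i = 0\<close> survives.\<close>
    have geo: "(\<Sum>j<N. \<zeta> i ^ j) = (if i = 0 then of_nat N else 0)" if "i < N" for i
    proof (cases "i = 0")
      case True
      then show ?thesis by (simp add: \<zeta>_def)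
    next
      case False
      have "\<zeta> i \<noteq> 1"
        using inj_onD[OF bij_betw_imp_inj_on[OF roots], of i 0] False that N(1)
        by (auto simp: \<zeta>_def)
      moreover have "\<zeta> i ^ N = 1"
        using roots that by (auto simp: bij_betw_def)
      ultimately show ?thesis using False by (simp add: geometric_sum)
    qed
    have "0 = (\<Sum>j<N. u j x)" using z by simp
    also have "\<dots> = (\<Sum>i<N. (\<Sum>j<N. \<zeta> i ^ j) * T (b [^] i) w x)"
      unfolding u_def by (subst sum.swap) (simp add: sum_distrib_right zz)
    also have "\<dots> = (\<Sum>i<N. if i = 0 then of_nat N * T (b [^] i) w x else 0)"
      by (intro sum.cong) (auto simp: geo)
    also have "\<dots> = of_nat N * w x"
      using N(1) one[OF w(1)] by simp
    finally show False using x N(1) by simp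
  qed
  then show ?thesis using uW eig other by meson
qed

text \<open>The elements of the finite set \<open>A\<close> are treated one after the other; passing
  to an eigenvector of the next element keeps the earlier eigenvalues. The resulting eigenvalues are
  multiplicative since the vector is nonzero somewhere.\<close>

lemma common_eigenvector:
  assumes w: "w \<in> W" "w \<noteq> (\<lambda>x. 0)"
  shows "\<exists>u\<in>W. \<exists>\<chi>. u \<noteq> (\<lambda>x. 0) \<and> lin_char G A \<chi> \<and> (\<forall>a\<in>A. T a u = (\<lambda>x. \<chi> a * u x))"
proof -
  have "\<exists>u\<in>W. u \<noteq> (\<lambda>x. 0) \<and> (\<forall>b\<in>F. \<exists>\<mu>. T b u = (\<lambda>x. \<mu> * u x))"
    if "finite F" "F \<subseteq> A" for F
    using that
  proof (induction F rule: finite_induct)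
    case empty
    then show ?case using w by auto
  next
    case (insert b F)
    then obtain v where v: "v \<in> W" "v \<noteq> (\<lambda>x. 0)" "\<forall>b\<in>F. \<exists>\<mu>. T b v = (\<lambda>x. \<mu> * v x)"
      by auto
    have b: "b \<in> A" using insert.prems by simp
    obtain u where u: "u \<in> W" "u \<noteq> (\<lambda>x. 0)" "\<exists>\<mu>. T b u = (\<lambda>x. \<mu> * u x)"
      and other: "\<forall>a\<in>A. \<forall>\<nu>. T a v = (\<lambda>x. \<nu> * v x) \<longrightarrow> T a u = (\<lambda>x. \<nu> * u x)"
      using eigenvector_of_finite_order[OF v(1,2) b]
      by (elim bexE conjE) simp
    have "\<exists>\<mu>. T a u = (\<lambda>x. \<mu> * u x)" if "a \<in> F" for a
      using v(3)[rule_format, OF that] other insert.prems that by (elim exE) blast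
    then show ?case using u by (intro bexI[of _ u]) simp_all
  qed
  moreover have "finite A" using A fin by (meson finite_subset subgroup.subset)
  ultimately obtain u where u: "u \<in> W" "u \<noteq> (\<lambda>x. 0)" "\<forall>b\<in>A. \<exists>\<mu>. T b u = (\<lambda>x. \<mu> * u x)"
    by blast
  then obtain \<chi> where \<chi>: "\<forall>b\<in>A. T b u = (\<lambda>x. \<chi> b * u x)"
    by metis
  obtain x where x: "u x \<noteq> 0" using u(2) by auto
  have "\<chi> \<one> * u x = u x"
    using \<chi> one[OF u(1)] subgroup.one_closed[OF A] by metis
  moreover have "\<chi> (a \<otimes> b) = \<chi> a * \<chi> b" if ab: "a \<in> A" "b \<in> A" for a b
  proof -
    have "T (a \<otimes> b) u = (\<lambda>x. \<chi> b * (\<chi> a * u x))"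
      using mult[OF ab u(1)] \<chi> ab linear_op_scale[OF lin[OF ab(1)]] by simp
    then have "\<chi> (a \<otimes> b) * u x = \<chi> b * (\<chi> a * u x)"
      using \<chi> subgroup.m_closed[OF A ab] by metis
    then show ?thesis using x by simp
  qed
  ultimately have "lin_char G A \<chi>"
    using x by (simp add: lin_char_def)
  then show ?thesis using u \<chi> by blast
qed

end

section \<open>Translation operators, extension of characters, cosets and counting\<close>

definition translate :: "('a, 'b) monoid_scheme \<Rightarrow> 'a set \<Rightarrow> 'a \<Rightarrow> ('a \<Rightarrow> complex) \<Rightarrow> 'a \<Rightarrow> complex"
  where "translate G A g f = (\<lambda>x. if x \<in> A then f (x \<otimes>\<^bsub>G\<^esub> g) else 0)"

lemma linear_op_translate: "linear_op (translate G A g)"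
  by (auto simp: linear_op_def translate_def fun_eq_iff)

context group
begin

lemma inv_cancel_left:
  "x \<in> carrier G \<Longrightarrow> y \<in> carrier G \<Longrightarrow> inv x \<otimes> (x \<otimes> y) = y"
  "x \<in> carrier G \<Longrightarrow> y \<in> carrier G \<Longrightarrow> x \<otimes> (inv x \<otimes> y) = y"
  by (simp_all flip: m_assoc)

text \<open>The extensions of a character \<open>\<chi>\<close> of \<open>B\<close> are the eigenvalue systems of the translations
  on the functions \<open>f\<close> with \<open>f (x \<otimes> z) = \<chi> z * f x\<close>, that is, on the induced representation.\<close>

lemma lin_char_extend:
  assumes fin: "finite (carrier G)" and A: "subgroup A G" and B: "subgroup B G" "B \<subseteq> A"
    and \<chi>: "lin_char G B \<chi>"
    and comm: "\<And>x y. x \<in> A \<Longrightarrow> y \<in> A \<Longrightarrow> \<exists>c\<in>B. \<chi> c = 1 \<and> x \<otimes> y = y \<otimes> x \<otimes> c"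
  shows "\<exists>\<psi>. lin_char G A \<psi> \<and> (\<forall>b\<in>B. \<psi> b = \<chi> b)"
proof -
  define W where "W = {f. (\<forall>x. x \<notin> A \<longrightarrow> f x = 0) \<and> (\<forall>x\<in>A. \<forall>z\<in>B. f (x \<otimes> z) = \<chi> z * f x)}"
  note [simp] = subgroup.mem_carrier[OF A] subgroup.m_closed[OF A] subgroup.m_closed[OF B(1)]
    subgroup.one_closed[OF A] subgroup.one_closed[OF B(1)] subsetD[OF B(2)]
  have BG [simp]: "z \<in> carrier G" if "z \<in> B" for z
    using that by simp
  interpret commuting_action G A W "translate G A"
  proof (intro commuting_action.intro commuting_action_axioms.intro)
    show "group G" by (rule is_group)
    show "finite (carrier G)" "subgroup A G" by fact+
    show "linear_op (translate G A a)" for a by (rule linear_op_translate)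
    show "(\<lambda>x. a * u x + v x) \<in> W" if "u \<in> W" "v \<in> W" for a u v
      using that by (auto simp: W_def algebra_simps)
    show "translate G A a w \<in> W" if a: "a \<in> A" and w: "w \<in> W" for a w
    proof -
      have "w (x \<otimes> z \<otimes> a) = \<chi> z * w (x \<otimes> a)" if xz: "x \<in> A" "z \<in> B" for x z
      proof -
        \<comment> \<open>Moving \<open>z\<close> past \<open>a\<close> costs a factor on which
          \<chi> is 1, so the condition that defines \<open>W\<close> survives translation.\<close>
        obtain c where c: "c \<in> B" "\<chi> c = 1" "z \<otimes> a = a \<otimes> z \<otimes> c"
          using comm[of z a] a xz by auto
        have "x \<otimes> z \<otimes> a = (x \<otimes> a) \<otimes> (z \<otimes> c)"
          using c xz a by (simp add: m_assoc)
        then show ?thesis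
          using w a xz c lin_char_mult[OF \<chi>, of z c] by (simp add: W_def)
      qed
      then show ?thesis by (auto simp: W_def translate_def)
    qed
    show "translate G A (a \<otimes> b) w = translate G A a (translate G A b w)"
      if "a \<in> A" "b \<in> A" "w \<in> W" for a b w
      using that by (auto simp: translate_def m_assoc fun_eq_iff)
    show "translate G A \<one> w = w" if "w \<in> W" for w
      using that by (auto simp: translate_def W_def fun_eq_iff)
    show "translate G A a (translate G A b w) = translate G A b (translate G A a w)"
      if ab: "a \<in> A" "b \<in> A" and w: "w \<in> W" for a b w
    proof -
      obtain c where c: "c \<in> B" "\<chi> c = 1" "a \<otimes> b = b \<otimes> a \<otimes> c"
        using comm ab by blast
      have "w (x \<otimes> a \<otimes> b) = w (x \<otimes> b \<otimes> a)" if "x \<in> A" for x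
      proof -
        have "x \<otimes> a \<otimes> b = (x \<otimes> b \<otimes> a) \<otimes> c"
          using c ab that by (simp add: m_assoc)
        then show ?thesis using w ab that c by (simp add: W_def)
      qed
      then show ?thesis using ab by (auto simp: translate_def fun_eq_iff)
    qed
  qed
  \<comment> \<open>The character \<chi> extended by zero shows that \<open>W\<close> is
    nonzero.\<close>
  define f where "f = (\<lambda>x. if x \<in> B then \<chi> x else 0)"
  have "f \<in> W"
  proof -
    have "x \<otimes> z \<in> B \<longleftrightarrow> x \<in> B" if "x \<in> A" "z \<in> B" for x z
    proof
      assume "x \<otimes> z \<in> B"
      then have "x \<otimes> z \<otimes> inv z \<in> B"
        using that B(1) by (simp add: subgroup.m_inv_closed)
      then show "x \<in> B" using that by (simp add: m_assoc)
    qed (use that in simp)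
    then show ?thesis
      using lin_char_mult[OF \<chi>] by (auto simp: W_def f_def)
  qed
  moreover have "f \<noteq> (\<lambda>x. 0)"
    using lin_char_one[OF \<chi>] by (auto simp: f_def fun_eq_iff intro!: exI[of _ \<one>])
  ultimately obtain u \<psi> where u: "u \<in> W" "u \<noteq> (\<lambda>x. 0)" and \<psi>: "lin_char G A \<psi>"
    and eig: "\<forall>a\<in>A. translate G A a u = (\<lambda>x. \<psi> a * u x)"
    using common_eigenvector by blast
  \<comment> \<open>Evaluating the eigenvector equation at \<one> makes \<open>u\<close> a multiple
    of \<psi> on \<open>A\<close>; comparison with the condition in \<open>W\<close> yields \<psi> =
    \<chi> on \<open>B\<close>.\<close>
  have eig1: "u a = \<psi> a * u \<one>" if "a \<in> A" for a
    using fun_cong[OF bspec[OF eig that], of \<one>] that by (simp add: translate_def)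
  have u1: "u \<one> \<noteq> 0"
  proof
    assume "u \<one> = 0"
    then have "u x = 0" for x
      using eig1[of x] u(1) by (cases "x \<in> A") (auto simp: W_def)
    then show False using u(2) by auto
  qed
  have uB: "u b = \<chi> b * u \<one>" if "b \<in> B" for b
  proof -
    have "u (\<one> \<otimes> b) = \<chi> b * u \<one>"
      using u(1) that subgroup.one_closed[OF A] unfolding W_def by blast
    then show ?thesis using that by simp
  qed
  have "\<psi> b = \<chi> b" if "b \<in> B" for b
    using eig1[OF subsetD[OF B(2) that]] uB[OF that] u1 by (metis mult_right_cancel)
  then show ?thesis using \<psi> by blast
qed

text \<open>\<open>R\<close> is a maximal set of elements of \<open>A\<close> in pairwise distinct
  right cosets of \<open>N\<close>; by maximality it meets every coset.\<close>

lemma right_transversal: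
  assumes fin: "finite (carrier G)" and A: "subgroup A G" and N: "subgroup N G" "N \<subseteq> A"
  shows "\<exists>R\<subseteq>A. card R * card N = card A \<and> (\<forall>x\<in>A. \<exists>r\<in>R. x \<otimes> inv r \<in> N) \<and>
    (\<forall>r\<in>R. \<forall>s\<in>R. r \<otimes> inv s \<in> N \<longrightarrow> r = s)"
proof -
  define P where "P = {R. R \<subseteq> A \<and> (\<forall>r\<in>R. \<forall>s\<in>R. r \<otimes> inv s \<in> N \<longrightarrow> r = s)}"
  note [simp] = subgroup.mem_carrier[OF A] subgroup.m_closed[OF A] subgroup.m_closed[OF N(1)]
    subgroup.one_closed[OF A] subgroup.one_closed[OF N(1)] subsetD[OF N(2)]
    subgroup.m_inv_closed[OF A] subgroup.m_inv_closed[OF N(1)]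
  have NG [simp]: "z \<in> carrier G" if "z \<in> N" for z
    using that by simp
  have finA: "finite A"
    using fin A by (meson finite_subset subgroup.subset)
  then have "finite P"
    by (intro finite_subset[of P "Pow A"]) (auto simp: P_def)
  moreover have "{} \<in> P" by (simp add: P_def)
  ultimately obtain R where R: "R \<in> P" and max: "\<And>R'. R' \<in> P \<Longrightarrow> R \<subseteq> R' \<Longrightarrow> R = R'"
    using finite_has_maximal[of P] by blast
  have RA: "R \<subseteq> A" and inj: "\<And>r s. r \<in> R \<Longrightarrow> s \<in> R \<Longrightarrow> r \<otimes> inv s \<in> N \<Longrightarrow> r = s"
    using R by (auto simp: P_def)
  have RG [simp]: "r \<in> carrier G" "r \<in> A" if "r \<in> R" for r
    using that RA by auto
  have cover: "\<exists>r\<in>R. x \<otimes> inv r \<in> N" if x: "x \<in> A" for x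
  proof (rule ccontr)
    assume no: "\<not> ?thesis"
    have sym: "s \<otimes> inv x \<notin> N" if "s \<in> R" for s
    proof
      assume "s \<otimes> inv x \<in> N"
      then have "inv (s \<otimes> inv x) \<in> N" by simp
      then show False using no that x by (auto simp: inv_mult_group)
    qed
    have "insert x R \<in> P"
      using no sym inj RA x unfolding P_def by auto
    then have "x \<in> R" using max by blast
    then show False using no x by auto
  qed
  have "bij_betw (\<lambda>(n, r). n \<otimes> r) (N \<times> R) A"
    unfolding bij_betw_def
  proof
    show "inj_on (\<lambda>(n, r). n \<otimes> r) (N \<times> R)"
    proof (rule inj_onI, clarify)
      fix n r n' r'
      assume *: "n \<in> N" "r \<in> R" "n' \<in> N" "r' \<in> R" "n \<otimes> r = n' \<otimes> r'"
      have "r \<otimes> inv r' = inv n \<otimes> (n \<otimes> r) \<otimes> inv r'"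
        using *(1-4) by (simp add: m_assoc inv_cancel_left)
      also have "\<dots> = inv n \<otimes> n'"
        unfolding *(5) using *(1-4) by (simp add: m_assoc)
      finally have "r = r'" using * inj by simp
      then show "n = n' \<and> r = r'" using * by simp
    qed
    have "x \<in> (\<lambda>(n, r). n \<otimes> r) ` (N \<times> R)" if x: "x \<in> A" for x
    proof -
      obtain r where r: "r \<in> R" "x \<otimes> inv r \<in> N" using cover[OF x] by blast
      then have "x = (x \<otimes> inv r) \<otimes> r" using x by (simp add: m_assoc)
      then show ?thesis using r by force
    qed
    then show "(\<lambda>(n, r). n \<otimes> r) ` (N \<times> R) = A" by auto
  qed
  then have "card (N \<times> R) = card A" by (rule bij_betw_same_card)
  then have "card R * card N = card A" by (simp add: card_cartesian_product mult.commute)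
  then show ?thesis using RA cover inj by (intro exI[of _ R]) auto
qed

text \<open>Distinct characters are eigenfunctions of the translations with distinct eigenvalues,
  hence independent. Being trivial on \<open>N\<close>, they are determined by their values on a
  transversal, which has \<open>card A / card N\<close> elements.\<close>

lemma card_lin_chars_le:
  assumes fin: "finite (carrier G)" and A: "subgroup A G" and N: "subgroup N G" "N \<subseteq> A"
    and "finite S"
    and \<mu>: "\<And>s. s \<in> S \<Longrightarrow> lin_char G A (\<mu> s)"
    and triv: "\<And>s n. s \<in> S \<Longrightarrow> n \<in> N \<Longrightarrow> \<mu> s n = 1"
    and dist: "\<And>s t. s \<in> S \<Longrightarrow> t \<in> S \<Longrightarrow> s \<noteq> t \<Longrightarrow> \<exists>g\<in>A. \<mu> s g \<noteq> \<mu> t g"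
  shows "card S * card N \<le> card A"
proof -
  obtain R where R: "R \<subseteq> A" "card R * card N = card A" "\<forall>x\<in>A. \<exists>r\<in>R. x \<otimes> inv r \<in> N"
    using right_transversal[OF fin A N] by blast
  have "finite R"
    using R(1) A fin by (meson finite_subset subgroup.subset)
  then have "card S \<le> card R"
  proof (rule card_independent_le[OF _ \<open>finite S\<close>, of _ \<mu>])
    fix c assume c: "\<forall>x\<in>R. (\<Sum>s\<in>S. c s * \<mu> s x) = 0"
    show "\<forall>s\<in>S. c s = 0"
    proof (rule independent_eigenfunctions[OF \<open>finite S\<close>, of A "translate G A"
          "\<lambda>s x. if x \<in> A then \<mu> s x else 0" \<mu>])
      show "linear_op (translate G A g)" for g by (rule linear_op_translate)
      show "translate G A g (\<lambda>x. if x \<in> A then \<mu> s x else 0)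
          = (\<lambda>x. \<mu> s g * (if x \<in> A then \<mu> s x else 0))" if "g \<in> A" "s \<in> S" for g s
        using that lin_char_mult[OF \<mu>] subgroup.m_closed[OF A]
        by (auto simp: translate_def fun_eq_iff)
      show "(\<lambda>x. if x \<in> A then \<mu> s x else 0) \<noteq> (\<lambda>x. 0)" if "s \<in> S" for s
        using lin_char_one[OF \<mu>[OF that]] subgroup.one_closed[OF A]
        by (auto simp: fun_eq_iff intro!: exI[of _ \<one>])
      show "\<exists>g\<in>A. \<mu> s g \<noteq> \<mu> t g" if "s \<in> S" "t \<in> S" "s \<noteq> t" for s t
        using dist that by blast
      have "(\<Sum>s\<in>S. c s * \<mu> s x) = 0" if x: "x \<in> A" for x
      proof -
        obtain r where r: "r \<in> R" "x \<otimes> inv r \<in> N" using R(3) x by blast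
        then have rA: "r \<in> A" "x \<otimes> inv r \<in> A" using R(1) N(2) by auto
        have "x = (x \<otimes> inv r) \<otimes> r"
          using x rA subgroup.mem_carrier[OF A] by (simp add: m_assoc)
        then have "\<mu> s x = \<mu> s r" if "s \<in> S" for s
          using lin_char_mult[OF \<mu>[OF that] rA(2,1)] triv[OF that r(2)] by simp
        then have "(\<Sum>s\<in>S. c s * \<mu> s x) = (\<Sum>s\<in>S. c s * \<mu> s r)" by simp
        then show ?thesis using c r by simp
      qed
      then have "(\<Sum>s\<in>S. c s * (if x \<in> A then \<mu> s x else 0)) = 0" for x
        by (cases "x \<in> A") simp_all
      then show "(\<lambda>x. \<Sum>s\<in>S. c s * (if x \<in> A then \<mu> s x else 0)) = (\<lambda>x. 0)"
        by simp
    qed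
  qed
  then show ?thesis using R(2) by (metis mult_le_mono1)
qed

end

section \<open>Matrix representations and their weights\<close>

text \<open>Relative to a subset \<open>A\<close> of the same group, so that restriction to a
  subgroup changes neither \<rho> nor \<open>G\<close>.\<close>

definition mat_rep :: "('a, 'b) monoid_scheme \<Rightarrow> 'a set \<Rightarrow> nat \<Rightarrow> ('a \<Rightarrow> complex mat) \<Rightarrow> bool" where
  "mat_rep G A n \<rho> \<longleftrightarrow> (\<forall>x\<in>A. \<rho> x \<in> carrier_mat n n) \<and>
     (\<forall>x\<in>A. \<forall>y\<in>A. \<rho> (x \<otimes>\<^bsub>G\<^esub> y) = \<rho> x * \<rho> y) \<and> \<rho> \<one>\<^bsub>G\<^esub> = 1\<^sub>m n"

text \<open>Column vectors are functions on the naturals that vanish from \<open>n\<close> on; the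
  result is cut off in the same way, so the lemmas on \<open>linear_op\<close> apply.\<close>

definition mat_apply :: "nat \<Rightarrow> complex mat \<Rightarrow> (nat \<Rightarrow> complex) \<Rightarrow> nat \<Rightarrow> complex" where
  "mat_apply n M v = (\<lambda>i. if i < n then \<Sum>j<n. M $$ (i, j) * v j else 0)"

lemma linear_op_mat_apply: "linear_op (mat_apply n M)"
  by (auto simp: linear_op_def mat_apply_def fun_eq_iff sum.distrib sum_distrib_left algebra_simps)

lemma mat_apply_mult:
  assumes "M \<in> carrier_mat n n" "N \<in> carrier_mat n n"
  shows "mat_apply n (M * N) v = mat_apply n M (mat_apply n N v)"
proof
  fix i
  show "mat_apply n (M * N) v i = mat_apply n M (mat_apply n N v) i"
  proof (cases "i < n")
    case True
    have "(\<Sum>j<n. (M * N) $$ (i, j) * v j) = (\<Sum>j<n. \<Sum>k<n. M $$ (i, k) * N $$ (k, j) * v j)"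
      using assms True
      by (intro sum.cong) (auto simp: scalar_prod_def sum_distrib_right lessThan_atLeast0)
    also have "\<dots> = (\<Sum>k<n. M $$ (i, k) * (\<Sum>j<n. N $$ (k, j) * v j))"
      by (subst sum.swap) (simp add: sum_distrib_left mult.assoc)
    finally show ?thesis using True by (simp add: mat_apply_def)
  qed (simp add: mat_apply_def)
qed

lemma mat_rep_apply_mult:
  assumes "mat_rep G A n \<rho>" "x \<in> A" "y \<in> A"
  shows "mat_apply n (\<rho> (x \<otimes>\<^bsub>G\<^esub> y)) v = mat_apply n (\<rho> x) (mat_apply n (\<rho> y) v)"
  using assms by (simp add: mat_rep_def mat_apply_mult)

lemma mat_apply_one:
  assumes "\<And>i. i \<ge> n \<Longrightarrow> v i = 0"
  shows "mat_apply n (1\<^sub>m n) v = v"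
proof
  fix i
  have "(\<Sum>j<n. 1\<^sub>m n $$ (i, j) * v j) = v i" if "i < n"
  proof -
    have "(\<Sum>j<n. 1\<^sub>m n $$ (i, j) * v j) = (\<Sum>j<n. if j = i then v j else 0)"
      using that by (intro sum.cong) auto
    then show ?thesis using that by simp
  qed
  then show "mat_apply n (1\<^sub>m n) v i = v i"
    using assms by (auto simp: mat_apply_def)
qed

text \<open>Characters that occur on a common eigenvector. Extensionality makes weights that agree
  on \<open>A\<close> equal, so that they can be counted as elements of a set.\<close>

definition weights :: "('a, 'b) monoid_scheme \<Rightarrow> 'a set \<Rightarrow> nat \<Rightarrow> ('a \<Rightarrow> complex mat) \<Rightarrow> ('a \<Rightarrow> complex) set"
  where "weights G A n \<rho> = {\<theta> \<in> extensional A. lin_char G A \<theta> \<and>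
    (\<exists>v. v \<noteq> (\<lambda>i. 0) \<and> (\<forall>i\<ge>n. v i = 0) \<and> (\<forall>a\<in>A. mat_apply n (\<rho> a) v = (\<lambda>i. \<theta> a * v i)))}"

lemma weights_lin_char: "\<theta> \<in> weights G A n \<rho> \<Longrightarrow> lin_char G A \<theta>"
  by (simp add: weights_def)

text \<open>Eigenvectors of distinct weights are independent functions on
  \<open>{..<n}\<close>.\<close>

lemma card_weights_le:
  "finite (weights G A n \<rho>) \<and> card (weights G A n \<rho>) \<le> n"
proof (rule finite_if_finite_subsets_card_bdd)
  fix F assume F: "F \<subseteq> weights G A n \<rho>" "finite F"
  have "\<forall>\<theta>\<in>F. \<exists>v. v \<noteq> (\<lambda>i. 0) \<and> (\<forall>i\<ge>n. v i = 0) \<and>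
      (\<forall>a\<in>A. mat_apply n (\<rho> a) v = (\<lambda>i. \<theta> a * v i))"
    using F(1) by (auto simp: weights_def)
  from bchoice[OF this] obtain v where v: "\<forall>\<theta>\<in>F. v \<theta> \<noteq> (\<lambda>i. 0) \<and> (\<forall>i\<ge>n. v \<theta> i = 0) \<and>
      (\<forall>a\<in>A. mat_apply n (\<rho> a) (v \<theta>) = (\<lambda>i. \<theta> a * v \<theta> i))"
    by blast
  have "card F \<le> card {..<n}"
  proof (rule card_independent_le[OF _ F(2), of _ v])
    fix c assume c: "\<forall>x\<in>{..<n}. (\<Sum>\<theta>\<in>F. c \<theta> * v \<theta> x) = 0"
    show "\<forall>\<theta>\<in>F. c \<theta> = 0"
    proof (rule independent_eigenfunctions[OF F(2), of A "\<lambda>a. mat_apply n (\<rho> a)" v "\<lambda>\<theta>. \<theta>"])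
      show "\<exists>a\<in>A. \<theta> a \<noteq> \<theta>' a" if "\<theta> \<in> F" "\<theta>' \<in> F" "\<theta> \<noteq> \<theta>'" for \<theta> \<theta>'
        using that F(1) extensionalityI[of \<theta> A \<theta>'] by (auto simp: weights_def)
      show "(\<lambda>x. \<Sum>\<theta>\<in>F. c \<theta> * v \<theta> x) = (\<lambda>x. 0)"
      proof
        fix x
        show "(\<Sum>\<theta>\<in>F. c \<theta> * v \<theta> x) = 0"
          using c v by (cases "x < n") auto
      qed
    qed (use v linear_op_mat_apply in simp_all)
  qed simp
  then show "card F \<le> n" by simp
qed

context group
begin

text \<open>The image of \<open>T a - 1\<close> is nonzero and is annihilated by the sum of the
  powers of \<open>a\<close>. A common eigenvector in the kernel of that sum has an eigenvalue other
  than 1 at \<open>a\<close>, since otherwise the sum would multiply it by \<open>N\<close>.\<close>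

lemma weights_separate:
  assumes fin: "finite (carrier G)" and A: "subgroup A G"
    and comm: "\<And>a b. a \<in> A \<Longrightarrow> b \<in> A \<Longrightarrow> a \<otimes> b = b \<otimes> a"
    and \<rho>: "mat_rep G A n \<rho>" and a: "a \<in> A" "\<rho> a \<noteq> 1\<^sub>m n"
  shows "\<exists>\<theta>\<in>weights G A n \<rho>. \<theta> a \<noteq> 1"
proof -
  define N where "N = order G"
  have N: "N > 0" "a [^] N = \<one>"
    using fin a subgroup.mem_carrier[OF A] by (auto simp: N_def order_gt_0_iff_finite pow_order_eq_1)
  have aA: "a [^] i \<in> A" for i :: nat
    using subgroup_nat_pow_closed[OF A a(1)] .
  define T where "T = (\<lambda>b. mat_apply n (\<rho> b))"
  have T_mult: "T (b \<otimes> c) v = T b (T c v)" if "b \<in> A" "c \<in> A" for b c v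
    using mat_rep_apply_mult[OF \<rho> that] by (simp add: T_def)
  have T_comm: "T b (T c v) = T c (T b v)" if "b \<in> A" "c \<in> A" for b c v
    using T_mult comm that by metis
  have T_one: "T \<one> v = v" if "\<And>i. i \<ge> n \<Longrightarrow> v i = 0" for v
    using \<rho> that by (simp add: T_def mat_rep_def mat_apply_one)
  have T_supp: "T b v i = 0" if "i \<ge> n" for b v i
    using that by (simp add: T_def mat_apply_def)
  have T_lin: "linear_op (T b)" for b
    unfolding T_def by (rule linear_op_mat_apply)
  \<comment> \<open>The kernel of the norm element \<open>\<Sum>i<N. a [^] i\<close>: on it, \<open>a\<close> cannot have the eigenvalue 1.\<close>
  define W where "W = {w. (\<forall>i\<ge>n. w i = 0) \<and> (\<forall>x. (\<Sum>i<N. T (a [^] i) w x) = 0)}"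
  interpret commuting_action G A W T
  proof (intro commuting_action.intro commuting_action_axioms.intro)
    show "group G" by (rule is_group)
    show "finite (carrier G)" "subgroup A G" by fact+
    show "linear_op (T b)" for b by (rule T_lin)
    show "(\<lambda>x. b * u x + v x) \<in> W" if "u \<in> W" "v \<in> W" for b u v
      using that by (simp add: W_def linear_op_add_scale[OF T_lin] sum.distrib flip: sum_distrib_left)
    show "T b w \<in> W" if b: "b \<in> A" and w: "w \<in> W" for b w
    proof -
      have "(\<Sum>i<N. T (a [^] i) (T b w) x) = 0" for x
      proof -
        have "(\<lambda>x. \<Sum>i<N. 1 * T (a [^] i) w x) = (\<lambda>x. 0)"
          using w by (simp add: W_def)
        then have "T b (\<lambda>x. \<Sum>i<N. 1 * T (a [^] i) w x) = (\<lambda>x. 0)"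
          using linear_op_zero[OF T_lin] by simp
        then have "(\<lambda>x. \<Sum>i<N. 1 * T b (T (a [^] i) w) x) = (\<lambda>x. 0)"
          by (subst (asm) linear_op_sum[OF T_lin]) simp_all
        then have "(\<Sum>i<N. T b (T (a [^] i) w) x) = 0"
          by (simp add: fun_eq_iff)
        then show ?thesis using T_comm[OF b aA] by simp
      qed
      then show ?thesis by (simp add: W_def T_supp)
    qed
    show "T (b \<otimes> c) w = T b (T c w)" if "b \<in> A" "c \<in> A" for b c w
      using T_mult that by blast
    show "T \<one> w = w" if "w \<in> W" for w
      using T_one that by (simp add: W_def)
    show "T b (T c w) = T c (T b w)" if "b \<in> A" "c \<in> A" for b c w
      using T_comm that by blast
  qed
  have "\<exists>v. (\<forall>i\<ge>n. v i = 0) \<and> T a v \<noteq> v"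
  proof (rule ccontr)
    assume "\<not> ?thesis"
    then have fix_v: "T a v = v" if "\<forall>i\<ge>n. v i = 0" for v
      using that by blast
    have "\<rho> a = 1\<^sub>m n"
    proof (rule eq_matI)
      show "dim_row (\<rho> a) = dim_row (1\<^sub>m n)" "dim_col (\<rho> a) = dim_col (1\<^sub>m n)"
        using \<rho> a(1) by (auto simp: mat_rep_def)
      fix i j assume ij: "i < dim_row (1\<^sub>m n)" "j < dim_col (1\<^sub>m n)"
      \<comment> \<open>Standard basis vectors recover the columns of the matrix.\<close>
      have "T a (\<lambda>k. if k = j then 1 else 0) i = (if i = j then 1 else 0)"
        using fix_v[of "\<lambda>k. if k = j then 1 else 0"] ij by simp
      then show "\<rho> a $$ (i, j) = 1\<^sub>m n $$ (i, j)"
        using ij by (simp add: T_def mat_apply_def if_distrib cong: if_cong)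
    qed
    then show False using a(2) by simp
  qed
  then obtain v where v: "\<forall>i\<ge>n. v i = 0" "T a v \<noteq> v" by blast
  define w where "w = (\<lambda>x. (- 1) * T a v x + v x)"
  have "w \<noteq> (\<lambda>x. 0)"
  proof
    assume "w = (\<lambda>x. 0)"
    then have "w x = 0" for x by simp
    then have "T a v x = v x" for x by (simp add: w_def)
    then show False using v(2) by auto
  qed
  moreover have "w \<in> W"
  proof -
    have "(\<Sum>i<N. T (a [^] i) w x) = 0" for x
    proof -
      define h where "h = (\<lambda>i. T (a [^] (i::nat)) v x)"
      \<comment> \<open>The sum telescopes, and the ends agree because
        \<open>a [^] N = \<one>\<close>.\<close>
      have "(\<Sum>i<N. T (a [^] i) w x) = (\<Sum>i<N. h i - h (Suc i))"
        unfolding w_def h_def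
        by (intro sum.cong refl) (use T_mult[OF aA a(1)] in \<open>simp add: linear_op_add_scale[OF T_lin, of _ "-1", simplified]\<close>)
      also have "\<dots> = h 0 - h N" by (rule sum_lessThan_telescope')
      also have "\<dots> = 0" using N(2) by (simp add: h_def)
      finally show ?thesis .
    qed
    then show ?thesis using v(1) by (simp add: W_def w_def T_supp)
  qed
  ultimately obtain u \<chi> where u: "u \<in> W" "u \<noteq> (\<lambda>x. 0)" and \<chi>: "lin_char G A \<chi>"
    and eig: "\<forall>b\<in>A. T b u = (\<lambda>x. \<chi> b * u x)"
    using common_eigenvector by blast
  have "\<chi> a \<noteq> 1"
  proof
    assume 1: "\<chi> a = 1"
    obtain x where x: "u x \<noteq> 0" using u(2) by auto
    have "T (a [^] i) u x = u x" for i :: nat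
      using eig aA lin_char_pow[OF \<chi> A a(1)] 1 by simp
    then have "(\<Sum>i<N. T (a [^] i) u x) = of_nat N * u x"
      by simp
    then have "of_nat N * u x = 0"
      using u(1) unfolding W_def by simp
    then show False using x N(1) by simp
  qed
  moreover have "restrict \<chi> A \<in> weights G A n \<rho>"
    using u eig \<chi> subgroup.one_closed[OF A] subgroup.m_closed[OF A]
    by (auto simp: weights_def lin_char_def T_def W_def intro!: exI[of _ u])
  ultimately show ?thesis using a(1) by (metis restrict_apply')
qed

text \<open>Rows and columns are indexed by a right transversal \<open>r\<close> of \<open>A\<close>; the \<open>(i, j)\<close> entry at \<open>g\<close>
  is \<open>\<theta> (r i \<otimes> g \<otimes> inv (r j))\<close>, or 0 if the argument lies outside \<open>A\<close>.\<close>

lemma induced_rep: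
  assumes fin: "finite (carrier G)" and A: "subgroup A G" and \<theta>: "lin_char G A \<theta>"
  obtains d \<rho> where "d * card A = order G" "mat_rep G (carrier G) d \<rho>"
    "\<And>g. g \<in> carrier G \<Longrightarrow> \<rho> g = 1\<^sub>m d \<Longrightarrow> \<exists>r\<in>carrier G. r \<otimes> g \<otimes> inv r \<in> A \<and> \<theta> (r \<otimes> g \<otimes> inv r) = 1"
proof -
  note [simp] = subgroup.mem_carrier[OF A] subgroup.m_closed[OF A] subgroup.one_closed[OF A]
    subgroup.m_inv_closed[OF A]
  obtain R where R: "R \<subseteq> carrier G" "card R * card A = order G"
    "\<forall>x\<in>carrier G. \<exists>r\<in>R. x \<otimes> inv r \<in> A"
    "\<forall>r\<in>R. \<forall>s\<in>R. r \<otimes> inv s \<in> A \<longrightarrow> r = s"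
    using right_transversal[OF fin subgroup_self A subgroup.subset[OF A]] unfolding order_def
    by blast
  have "finite R" using R(1) fin by (rule finite_subset)
  define d where "d = card R"
  obtain r where r: "bij_betw r {..<d} R"
    using ex_bij_betw_nat_finite[OF \<open>finite R\<close>] by (auto simp: d_def lessThan_atLeast0)
  have rR: "r i \<in> R" "r i \<in> carrier G" if "i < d" for i
    using bij_betwE[OF r] that R(1) by auto
  have r_inj: "i = j" if "i < d" "j < d" "r i \<otimes> inv (r j) \<in> A" for i j
    using R(4)[rule_format, OF rR(1)[OF that(1)] rR(1)[OF that(2)] that(3)] bij_betw_imp_inj_on[OF r] that
    by (auto simp: inj_on_def)
  \<comment> \<open>The character \<theta> extended by zero outside \<open>A\<close>.\<close>
  define \<Lambda> where "\<Lambda> = (\<lambda>x. if x \<in> A then \<theta> x else 0)"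
  define \<rho> where "\<rho> = (\<lambda>g. mat d d (\<lambda>(i, j). \<Lambda> (r i \<otimes> g \<otimes> inv (r j))))"
  have dim: "\<rho> g \<in> carrier_mat d d" for g by (simp add: \<rho>_def)
  have mult: "\<rho> (g \<otimes> h) = \<rho> g * \<rho> h" if gh: "g \<in> carrier G" "h \<in> carrier G" for g h
  proof (rule eq_matI)
    fix i k assume "i < dim_row (\<rho> g * \<rho> h)" "k < dim_col (\<rho> g * \<rho> h)"
    then have ik: "i < d" "k < d" by (auto simp: \<rho>_def)
    \<comment> \<open>Exactly one coset representative \<open>r j\<close> belongs to
      \<open>r i \<otimes> g\<close>; row \<open>i\<close> of \<open>\<rho> g\<close> has its only
      possible nonzero entry there, and the matrix product reduces to one term.\<close>
    obtain j where j: "j < d" "r i \<otimes> g \<otimes> inv (r j) \<in> A"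
      using bspec[OF R(3), of "r i \<otimes> g"] rR ik gh bij_betw_imp_surj_on[OF r] by (auto simp: image_iff)
    have uniq: "l = j" if l: "l < d" "r i \<otimes> g \<otimes> inv (r l) \<in> A" for l
    proof -
      have "inv (r i \<otimes> g \<otimes> inv (r l)) \<otimes> (r i \<otimes> g \<otimes> inv (r j)) \<in> A"
        using j l by simp
      also have "inv (r i \<otimes> g \<otimes> inv (r l)) \<otimes> (r i \<otimes> g \<otimes> inv (r j)) = r l \<otimes> inv (r j)"
        using rR ik j l gh by (simp add: inv_mult_group m_assoc inv_cancel_left)
      finally show ?thesis using r_inj l(1) j(1) by blast
    qed
    have "(\<rho> g * \<rho> h) $$ (i, k)
        = (\<Sum>l<d. \<Lambda> (r i \<otimes> g \<otimes> inv (r l)) * \<Lambda> (r l \<otimes> h \<otimes> inv (r k)))"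
      using ik by (simp add: \<rho>_def scalar_prod_def lessThan_atLeast0)
    also have "\<dots> = (\<Sum>l<d. if l = j then \<Lambda> (r i \<otimes> g \<otimes> inv (r j)) * \<Lambda> (r j \<otimes> h \<otimes> inv (r k)) else 0)"
    proof (intro sum.cong refl)
      fix l assume "l \<in> {..<d}"
      then show "\<Lambda> (r i \<otimes> g \<otimes> inv (r l)) * \<Lambda> (r l \<otimes> h \<otimes> inv (r k))
          = (if l = j then \<Lambda> (r i \<otimes> g \<otimes> inv (r j)) * \<Lambda> (r j \<otimes> h \<otimes> inv (r k)) else 0)"
        using uniq[of l] by (cases "r i \<otimes> g \<otimes> inv (r l) \<in> A") (auto simp: \<Lambda>_def)
    qed
    also have "\<dots> = \<Lambda> (r i \<otimes> g \<otimes> inv (r j)) * \<Lambda> (r j \<otimes> h \<otimes> inv (r k))"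
      using j(1) by simp
    also have "\<dots> = \<Lambda> (r i \<otimes> (g \<otimes> h) \<otimes> inv (r k))"
    proof -
      define x y where "x = r i \<otimes> g \<otimes> inv (r j)" and "y = r j \<otimes> h \<otimes> inv (r k)"
      have xy: "x \<in> A" "y \<in> carrier G" using j rR ik gh by (auto simp: x_def y_def)
      have eq: "r i \<otimes> (g \<otimes> h) \<otimes> inv (r k) = x \<otimes> y"
        using j rR ik gh by (simp add: x_def y_def m_assoc inv_cancel_left)
      have "x \<otimes> y \<in> A \<longleftrightarrow> y \<in> A"
      proof
        assume "x \<otimes> y \<in> A"
        then have "inv x \<otimes> (x \<otimes> y) \<in> A" using xy by simp
        then show "y \<in> A" using xy by (simp add: m_assoc[symmetric])
      qed (use xy in simp)
      then show ?thesis
        unfolding eq x_def[symmetric] y_def[symmetric]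
        using lin_char_mult[OF \<theta> xy(1)] xy(1) by (auto simp: \<Lambda>_def)
    qed
    finally show "\<rho> (g \<otimes> h) $$ (i, k) = (\<rho> g * \<rho> h) $$ (i, k)"
      using ik by (simp add: \<rho>_def)
  qed (auto simp: \<rho>_def)
  have one: "\<rho> \<one> = 1\<^sub>m d"
  proof (rule eq_matI)
    fix i j assume "i < dim_row (1\<^sub>m d)" "j < dim_col (1\<^sub>m d)"
    then show "\<rho> \<one> $$ (i, j) = 1\<^sub>m d $$ (i, j)"
      using r_inj[of i j] rR lin_char_one[OF \<theta>] by (auto simp: \<rho>_def \<Lambda>_def)
  qed (auto simp: \<rho>_def)
  show ?thesis
  proof (rule that[of d \<rho>])
    show "d * card A = order G" using R(2) by (simp add: d_def)
    show "mat_rep G (carrier G) d \<rho>" using dim mult one by (simp add: mat_rep_def)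
    fix g assume g: "g \<in> carrier G" "\<rho> g = 1\<^sub>m d"
    have "R \<noteq> {}" using bspec[OF R(3) one_closed] by blast
    then have "d > 0" using \<open>finite R\<close> by (simp add: d_def card_gt_0_iff)
    \<comment> \<open>One diagonal entry suffices: its value 1 is not the default 0, so the
      conjugate of \<open>g\<close> lies in \<open>A\<close>.\<close>
    then have "\<Lambda> (r 0 \<otimes> g \<otimes> inv (r 0)) = 1"
      using arg_cong[OF g(2), of "\<lambda>M. M $$ (0, 0)"] by (simp add: \<rho>_def)
    then show "\<exists>r\<in>carrier G. r \<otimes> g \<otimes> inv r \<in> A \<and> \<theta> (r \<otimes> g \<otimes> inv r) = 1"
      using rR(2)[OF \<open>d > 0\<close>] by (intro bexI[of _ "r 0"]) (auto simp: \<Lambda>_def split: if_splits)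
  qed
qed

end

section \<open>Direct sums of representations and of characters\<close>

lemma faithful_rep_iff:
  "faithful_rep G n \<rho> \<longleftrightarrow> mat_rep G (carrier G) n \<rho> \<and> inj_on \<rho> (carrier G)"
  by (auto simp: faithful_rep_def mat_rep_def)

lemma mat_rep_subset: "mat_rep G A n \<rho> \<Longrightarrow> B \<subseteq> A \<Longrightarrow> mat_rep G B n \<rho>"
  by (auto simp: mat_rep_def)

lemma mat_rep_direct_sum:
  assumes "mat_rep G A m \<rho>" "mat_rep G A n \<sigma>"
  shows "mat_rep G A (m + n) (\<lambda>x. four_block_mat (\<rho> x) (0\<^sub>m m n) (0\<^sub>m n m) (\<sigma> x))"
proof -
  have "four_block_mat (\<rho> x) (0\<^sub>m m n) (0\<^sub>m n m) (\<sigma> x) * four_block_mat (\<rho> y) (0\<^sub>m m n) (0\<^sub>m n m) (\<sigma> y)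
      = four_block_mat (\<rho> x * \<rho> y) (0\<^sub>m m n) (0\<^sub>m n m) (\<sigma> x * \<sigma> y)" if "x \<in> A" "y \<in> A" for x y
  proof -
    have "\<rho> x \<in> carrier_mat m m" "\<rho> y \<in> carrier_mat m m" "\<sigma> x \<in> carrier_mat n n" "\<sigma> y \<in> carrier_mat n n"
      using assms that by (auto simp: mat_rep_def)
    then show ?thesis
      by (subst mult_four_block_mat[of _ m m _ n _ n _ _ m _ n]) auto
  qed
  then show ?thesis
    using assms by (auto simp: mat_rep_def four_block_one_mat)
qed

lemma four_block_diag_eq_one:
  fixes B C :: "complex mat"
  assumes "B \<in> carrier_mat m m" "C \<in> carrier_mat n n"
    and "four_block_mat B (0\<^sub>m m n) (0\<^sub>m n m) C = 1\<^sub>m (m + n)"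
  shows "B = 1\<^sub>m m" "C = 1\<^sub>m n"
proof -
  have eq: "four_block_mat B (0\<^sub>m m n) (0\<^sub>m n m) C $$ (i, j) = 1\<^sub>m (m + n) $$ (i, j)" for i j
    using assms(3) by simp
  show "B = 1\<^sub>m m"
  proof (rule eq_matI)
    fix i j assume "i < dim_row (1\<^sub>m m)" "j < dim_col (1\<^sub>m m)"
    then show "B $$ (i, j) = 1\<^sub>m m $$ (i, j)"
      using eq[of i j] assms(1,2) by simp
  qed (use assms in auto)
  show "C = 1\<^sub>m n"
  proof (rule eq_matI)
    fix i j assume "i < dim_row (1\<^sub>m n)" "j < dim_col (1\<^sub>m n)"
    then show "C $$ (i, j) = 1\<^sub>m n $$ (i, j)"
      using eq[of "m + i" "m + j"] assms(1,2) by simp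
  qed (use assms in auto)
qed

text \<open>Diagonal matrices with the characters as entries; the kernel lies in the common kernel
  of the characters.\<close>

lemma diagonal_rep:
  assumes "finite S" "\<And>s. s \<in> S \<Longrightarrow> lin_char G A (\<psi> s)"
  shows "\<exists>\<rho>. mat_rep G A (card S) \<rho> \<and> (\<forall>x\<in>A. \<rho> x = 1\<^sub>m (card S) \<longrightarrow> (\<forall>s\<in>S. \<psi> s x = 1))"
proof -
  define n where "n = card S"
  obtain e where e: "bij_betw e {..<n} S"
    using ex_bij_betw_nat_finite[OF assms(1)] by (auto simp: n_def lessThan_atLeast0)
  have char: "lin_char G A (\<psi> (e i))" if "i < n" for i
    using assms(2) bij_betwE[OF e] that by simp
  define \<rho> where "\<rho> = (\<lambda>x. mat n n (\<lambda>(i, j). if i = j then \<psi> (e i) x else 0))"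
  have "mat_rep G A n \<rho>"
    unfolding mat_rep_def
  proof (intro conjI ballI)
    show "\<rho> x \<in> carrier_mat n n" for x by (simp add: \<rho>_def)
    show "\<rho> \<one>\<^bsub>G\<^esub> = 1\<^sub>m n"
      by (rule eq_matI) (auto simp: \<rho>_def lin_char_one[OF char])
    fix x y assume xy: "x \<in> A" "y \<in> A"
    show "\<rho> (x \<otimes>\<^bsub>G\<^esub> y) = \<rho> x * \<rho> y"
    proof (rule eq_matI)
      fix i j assume "i < dim_row (\<rho> x * \<rho> y)" "j < dim_col (\<rho> x * \<rho> y)"
      then have ij: "i < n" "j < n" by (auto simp: \<rho>_def)
      have "(\<rho> x * \<rho> y) $$ (i, j)
          = (\<Sum>k<n. (if i = k then \<psi> (e i) x else 0) * (if k = j then \<psi> (e k) y else 0))"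
        using ij by (simp add: \<rho>_def scalar_prod_def lessThan_atLeast0)
      also have "\<dots> = (\<Sum>k<n. if k = i then \<psi> (e i) x * (if i = j then \<psi> (e i) y else 0) else 0)"
        by (intro sum.cong) auto
      also have "\<dots> = (if i = j then \<psi> (e i) x * \<psi> (e i) y else 0)"
        using ij by simp
      finally show "\<rho> (x \<otimes>\<^bsub>G\<^esub> y) $$ (i, j) = (\<rho> x * \<rho> y) $$ (i, j)"
        using ij lin_char_mult[OF char xy] by (simp add: \<rho>_def)
    qed (auto simp: \<rho>_def)
  qed
  moreover have "\<psi> s x = 1" if x: "\<rho> x = 1\<^sub>m n" and s: "s \<in> S" for x s
  proof -
    obtain i where "i < n" "e i = s"
      using bij_betw_imp_surj_on[OF e] s by auto
    then show ?thesis
      using arg_cong[OF x, of "\<lambda>M. M $$ (i, i)"] by (simp add: \<rho>_def)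
  qed
  ultimately show ?thesis unfolding n_def by blast
qed

section \<open>Kernels, the minimal faithful dimension and maximal commuting subgroups\<close>

context group
begin

lemma mat_rep_inj_onI:
  assumes \<rho>: "mat_rep G A n \<rho>" and A: "subgroup A G"
    and ker: "\<And>x. x \<in> A \<Longrightarrow> \<rho> x = 1\<^sub>m n \<Longrightarrow> x = \<one>"
  shows "inj_on \<rho> A"
proof (rule inj_onI)
  fix x y assume xy: "x \<in> A" "y \<in> A" "\<rho> x = \<rho> y"
  have iy: "inv y \<in> A" and G: "x \<in> carrier G" "y \<in> carrier G"
    using xy A by (auto simp: subgroup.m_inv_closed subgroup.mem_carrier)
  have "\<rho> (x \<otimes> inv y) = \<rho> (y \<otimes> inv y)"
    using \<rho> xy iy by (simp add: mat_rep_def)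
  also have "\<dots> = 1\<^sub>m n"
    using \<rho> G by (simp add: mat_rep_def)
  finally have "x \<otimes> inv y = \<one>"
    using ker xy iy subgroup.m_closed[OF A] by blast
  then show "x = y"
    using G by (metis inv_equality inv_inv inv_closed)
qed

lemma mat_rep_inj_onD:
  assumes "mat_rep G A n \<rho>" "subgroup A G" "inj_on \<rho> A" "x \<in> A" "\<rho> x = 1\<^sub>m n"
  shows "x = \<one>"
  using assms(1,5) inj_onD[OF assms(3) _ assms(4) subgroup.one_closed[OF assms(2)]]
  by (simp add: mat_rep_def)

lemma faithful_rep_subgroup_generated:
  assumes "subgroup A G"
  shows "faithful_rep (subgroup_generated G A) n \<rho> \<longleftrightarrow> mat_rep G A n \<rho> \<and> inj_on \<rho> A"
  using subgroup.carrier_subgroup_generated_subgroup[OF assms]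
  by (simp add: faithful_rep_iff mat_rep_def)

text \<open>The regular representation, obtained by inducing from the trivial subgroup. It ensures
  that the minimum in \<open>m_faithful\<close> is attained.\<close>

lemma ex_faithful_rep:
  assumes "finite (carrier G)"
  shows "\<exists>n \<rho>. mat_rep G (carrier G) n \<rho> \<and> inj_on \<rho> (carrier G)"
proof -
  have "lin_char G {\<one>} (\<lambda>x. 1)" by (simp add: lin_char_def)
  then obtain d \<rho> where \<rho>: "mat_rep G (carrier G) d \<rho>"
    and ker: "\<And>g. g \<in> carrier G \<Longrightarrow> \<rho> g = 1\<^sub>m d \<Longrightarrow> \<exists>r\<in>carrier G. r \<otimes> g \<otimes> inv r \<in> {\<one>}"
    using induced_rep[OF assms triv_subgroup] by metis
  have "inj_on \<rho> (carrier G)"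
  proof (rule mat_rep_inj_onI[OF \<rho> subgroup_self])
    fix g assume g: "g \<in> carrier G" "\<rho> g = 1\<^sub>m d"
    then obtain r where r: "r \<in> carrier G" "r \<otimes> g \<otimes> inv r = \<one>"
      using ker by blast
    then have "r \<otimes> g = r"
      using g by (metis inv_closed inv_equality inv_inv m_closed)
    then show "g = \<one>" using r(1) g(1) by simp
  qed
  then show ?thesis using \<rho> by blast
qed

lemma m_faithful_le:
  "mat_rep G (carrier G) n \<rho> \<Longrightarrow> inj_on \<rho> (carrier G) \<Longrightarrow> m_faithful G \<le> n"
  unfolding m_faithful_def by (intro Least_le) (auto simp: faithful_rep_iff)

lemma m_faithful_attained:
  assumes "finite (carrier G)"
  shows "\<exists>\<rho>. mat_rep G (carrier G) (m_faithful G) \<rho> \<and> inj_on \<rho> (carrier G)"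
proof -
  have "\<exists>n \<rho>. faithful_rep G n \<rho>"
    using ex_faithful_rep[OF assms] by (simp add: faithful_rep_iff)
  then have "\<exists>\<rho>. faithful_rep G (m_faithful G) \<rho>"
    unfolding m_faithful_def by (rule LeastI_ex)
  then show ?thesis by (simp add: faithful_rep_iff)
qed

lemma m_faithful_subgroup_le:
  "subgroup A G \<Longrightarrow> mat_rep G A n \<rho> \<Longrightarrow> inj_on \<rho> A \<Longrightarrow> m_faithful (subgroup_generated G A) \<le> n"
  unfolding m_faithful_def by (intro Least_le) (auto simp: faithful_rep_subgroup_generated)

lemma m_faithful_subgroup_attained:
  assumes "finite (carrier G)" "subgroup A G"
  shows "\<exists>\<rho>. mat_rep G A (m_faithful (subgroup_generated G A)) \<rho> \<and> inj_on \<rho> A"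
proof -
  have "finite A"
    using assms by (meson finite_subset subgroup.subset)
  then have "\<exists>\<rho>. faithful_rep (subgroup_generated G A) (m_faithful (subgroup_generated G A)) \<rho>"
    using group.m_faithful_attained[OF group_subgroup_generated, of A]
      subgroup.carrier_subgroup_generated_subgroup[OF assms(2)]
    by (simp add: faithful_rep_iff)
  then show ?thesis using faithful_rep_subgroup_generated[OF assms(2)] by simp
qed

text \<open>A maximal set of pairwise commuting elements contains everything that commutes with all
  of it. Closure under the group operations follows, since products and inverses of its elements
  commute with it.\<close>

lemma ex_maximal_commuting_subgroup:
  assumes "finite (carrier G)"
  shows "\<exists>A. subgroup A G \<and> group_center G \<subseteq> A \<and> (\<forall>a\<in>A. \<forall>b\<in>A. a \<otimes> b = b \<otimes> a) \<and>
    (\<forall>h\<in>carrier G. (\<forall>a\<in>A. h \<otimes> a = a \<otimes> h) \<longrightarrow> h \<in> A)"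
proof -
  define P where "P = {A. A \<subseteq> carrier G \<and> (\<forall>a\<in>A. \<forall>b\<in>A. a \<otimes> b = b \<otimes> a)}"
  have "finite P"
    by (rule finite_subset[of P "Pow (carrier G)"]) (use assms in \<open>auto simp: P_def\<close>)
  moreover have "{} \<in> P" by (simp add: P_def)
  ultimately obtain A where A: "A \<in> P" and max: "\<And>B. B \<in> P \<Longrightarrow> A \<subseteq> B \<Longrightarrow> A = B"
    using finite_has_maximal[of P] by blast
  have AG: "a \<in> carrier G" if "a \<in> A" for a
    using A that by (auto simp: P_def)
  have comm: "a \<otimes> b = b \<otimes> a" if "a \<in> A" "b \<in> A" for a b
    using A that by (auto simp: P_def)
  have self: "h \<in> A" if h: "h \<in> carrier G" "\<And>a. a \<in> A \<Longrightarrow> h \<otimes> a = a \<otimes> h" for h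
  proof -
    have "insert h A \<in> P"
      using A h by (simp add: P_def)
    then have "A = insert h A" by (rule max) blast
    then show ?thesis by blast
  qed
  have "subgroup A G"
  proof
    show "A \<subseteq> carrier G" using AG by blast
    show "\<one> \<in> A" by (rule self) (auto simp: AG)
    show "x \<otimes> y \<in> A" if xy: "x \<in> A" "y \<in> A" for x y
    proof (rule self)
      fix a assume a: "a \<in> A"
      have "x \<otimes> y \<otimes> a = x \<otimes> (a \<otimes> y)"
        using xy a by (simp add: AG m_assoc comm[of y a])
      also have "\<dots> = a \<otimes> x \<otimes> y"
        using xy a by (simp add: AG m_assoc[symmetric] comm[of x a])
      finally show "x \<otimes> y \<otimes> a = a \<otimes> (x \<otimes> y)"
        using xy a by (simp add: AG m_assoc)
    qed (use xy AG in simp)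
    show "inv x \<in> A" if x: "x \<in> A" for x
    proof (rule self)
      fix a assume a: "a \<in> A"
      have "inv x \<otimes> a = inv x \<otimes> (a \<otimes> x) \<otimes> inv x"
        using x a by (simp add: AG m_assoc)
      also have "\<dots> = a \<otimes> inv x"
        unfolding comm[OF a x] using x a by (simp add: AG m_assoc[symmetric])
      finally show "inv x \<otimes> a = a \<otimes> inv x" .
    qed (use x AG in simp)
  qed
  moreover have "group_center G \<subseteq> A"
    using self AG by (auto simp: group_center_def)
  ultimately show ?thesis using comm self by blast
qed

end

section \<open>Finite p-groups with cyclic central commutator subgroup\<close>

text \<open>A central commutator subgroup expresses nilpotency class at most two; abelian groups are
  included and form a separate case at the end.\<close>

locale cyclic_derived_p_group = group G for G (structure) +
  fixes p :: nat
  assumes fin: "finite (carrier G)"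
    and prime: "Factorial_Ring.prime p"
    and p_group: "\<exists>k. card (carrier G) = p ^ k"
    and derived_central: "derived G (carrier G) \<subseteq> group_center G"
    and derived_cyclic: "cyclic_group (subgroup_generated G (derived G (carrier G)))"
begin

abbreviation "Z \<equiv> group_center G"
abbreviation "D \<equiv> derived G (carrier G)"

text \<open>This order of the factors matches the generators of \<open>derived\<close>.\<close>

definition comm :: "'a \<Rightarrow> 'a \<Rightarrow> 'a" where
  "comm x y = x \<otimes> y \<otimes> inv x \<otimes> inv y"

lemma center_subset: "z \<in> Z \<Longrightarrow> z \<in> carrier G"
  by (simp add: group_center_def)

lemma center_commute: "z \<in> Z \<Longrightarrow> g \<in> carrier G \<Longrightarrow> z \<otimes> g = g \<otimes> z"
  by (simp add: group_center_def)

lemma subgroup_center: "subgroup Z G"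
proof
  show "Z \<subseteq> carrier G" using center_subset by blast
  show "\<one> \<in> Z" by (simp add: group_center_def)
  show "x \<otimes> y \<in> Z" if "x \<in> Z" "y \<in> Z" for x y
  proof -
    have "x \<otimes> y \<otimes> g = g \<otimes> (x \<otimes> y)" if g: "g \<in> carrier G" for g
    proof -
      have xy: "x \<in> carrier G" "y \<in> carrier G"
        using that center_subset \<open>x \<in> Z\<close> \<open>y \<in> Z\<close> by blast+
      have "x \<otimes> y \<otimes> g = x \<otimes> (g \<otimes> y)"
        using xy g center_commute[OF \<open>y \<in> Z\<close> g] by (simp add: m_assoc)
      also have "\<dots> = g \<otimes> x \<otimes> y"
        using xy g center_commute[OF \<open>x \<in> Z\<close> g] by (simp add: m_assoc[symmetric])
      finally show ?thesis using xy g by (simp add: m_assoc)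
    qed
    moreover have "x \<otimes> y \<in> carrier G" using that center_subset by blast
    ultimately show ?thesis unfolding group_center_def by blast
  qed
  show "inv x \<in> Z" if x: "x \<in> Z" for x
  proof -
    have "inv x \<otimes> g = g \<otimes> inv x" if g: "g \<in> carrier G" for g
    proof -
      have "inv x \<otimes> g = inv x \<otimes> (g \<otimes> x) \<otimes> inv x"
        using x g by (simp add: center_subset m_assoc)
      also have "\<dots> = g \<otimes> inv x"
        unfolding center_commute[OF x g, symmetric]
        using x g by (simp add: center_subset m_assoc inv_cancel_left)
      finally show ?thesis .
    qed
    moreover have "inv x \<in> carrier G" using x center_subset by blast
    ultimately show ?thesis unfolding group_center_def by blast
  qed
qed

lemma subgroup_derived: "subgroup D G"
  by (rule derived_is_subgroup) simp

lemma derived_in_center: "x \<in> D \<Longrightarrow> x \<in> Z"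
  using derived_central by blast

section \<open>The commutator as a bilinear pairing with central values\<close>

lemma comm_in_derived: "x \<in> carrier G \<Longrightarrow> y \<in> carrier G \<Longrightarrow> comm x y \<in> D"
  unfolding comm_def derived_def by (intro generate.incl) blast

lemma comm_in_center: "x \<in> carrier G \<Longrightarrow> y \<in> carrier G \<Longrightarrow> comm x y \<in> Z"
  using comm_in_derived derived_in_center by blast

lemma comm_closed: "x \<in> carrier G \<Longrightarrow> y \<in> carrier G \<Longrightarrow> comm x y \<in> carrier G"
  by (simp add: comm_def)

lemma mult_eq_comm: "x \<in> carrier G \<Longrightarrow> y \<in> carrier G \<Longrightarrow> x \<otimes> y = comm x y \<otimes> (y \<otimes> x)"
  by (simp add: comm_def m_assoc inv_cancel_left)

text \<open>Commutators are computed by reordering products and collecting central factors, without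
  handling inverses.\<close>

lemma comm_unique:
  assumes "x \<in> carrier G" "y \<in> carrier G" "c \<in> carrier G" "x \<otimes> y = c \<otimes> (y \<otimes> x)"
  shows "comm x y = c"
proof -
  have "comm x y \<otimes> (y \<otimes> x) = c \<otimes> (y \<otimes> x)"
    using assms(4) mult_eq_comm[OF assms(1,2)] by simp
  then show ?thesis using assms comm_closed by simp
qed

lemma comm_eq_one_iff:
  assumes "x \<in> carrier G" "y \<in> carrier G"
  shows "comm x y = \<one> \<longleftrightarrow> x \<otimes> y = y \<otimes> x"
proof
  assume "comm x y = \<one>"
  then show "x \<otimes> y = y \<otimes> x" using mult_eq_comm[OF assms] assms by (metis l_one m_closed)
next
  assume "x \<otimes> y = y \<otimes> x"
  then show "comm x y = \<one>" using assms by (intro comm_unique) auto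
qed

lemma comm_mult_left:
  assumes x: "x \<in> carrier G" and y: "y \<in> carrier G" and z: "z \<in> carrier G"
  shows "comm (x \<otimes> y) z = comm x z \<otimes> comm y z"
proof (rule comm_unique)
  define c d where "c = comm x z" and "d = comm y z"
  have cd: "c \<in> carrier G" "d \<in> carrier G" "d \<in> Z"
    using assms comm_closed comm_in_center by (auto simp: c_def d_def)
  have "x \<otimes> y \<otimes> z = x \<otimes> d \<otimes> (z \<otimes> y)"
    using assms cd mult_eq_comm[of y z] by (simp add: m_assoc d_def)
  also have "\<dots> = d \<otimes> (x \<otimes> z) \<otimes> y"
    using assms cd center_commute[of d x] by (simp add: m_assoc[symmetric])
  also have "\<dots> = d \<otimes> c \<otimes> (z \<otimes> (x \<otimes> y))"
    using assms cd mult_eq_comm[of x z] by (simp add: m_assoc c_def)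
  finally show "x \<otimes> y \<otimes> z = comm x z \<otimes> comm y z \<otimes> (z \<otimes> (x \<otimes> y))"
    using center_commute[of d c] cd by (simp add: c_def d_def)
qed (use assms comm_closed in auto)

lemma comm_mult_right:
  assumes x: "x \<in> carrier G" and y: "y \<in> carrier G" and z: "z \<in> carrier G"
  shows "comm x (y \<otimes> z) = comm x y \<otimes> comm x z"
proof (rule comm_unique)
  define c d where "c = comm x y" and "d = comm x z"
  have cd: "c \<in> carrier G" "d \<in> carrier G" "d \<in> Z"
    using assms comm_closed comm_in_center by (auto simp: c_def d_def)
  have "x \<otimes> (y \<otimes> z) = c \<otimes> y \<otimes> (x \<otimes> z)"
    using assms cd mult_eq_comm[of x y] by (simp add: m_assoc[symmetric] c_def)
  also have "\<dots> = c \<otimes> (y \<otimes> d) \<otimes> (z \<otimes> x)"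
    using assms cd mult_eq_comm[of x z] by (simp add: m_assoc d_def)
  also have "\<dots> = c \<otimes> d \<otimes> (y \<otimes> z \<otimes> x)"
    unfolding center_commute[OF cd(3) y, symmetric] using assms cd by (simp add: m_assoc)
  finally show "x \<otimes> (y \<otimes> z) = comm x y \<otimes> comm x z \<otimes> (y \<otimes> z \<otimes> x)"
    by (simp add: c_def d_def)
qed (use assms comm_closed in auto)

lemma comm_one_right: "x \<in> carrier G \<Longrightarrow> comm x \<one> = \<one>"
  by (simp add: comm_eq_one_iff)

lemma lin_char_comm:
  assumes "lin_char G D \<chi>" "x \<in> carrier G" "Q \<subseteq> carrier G"
  shows "lin_char G Q (\<lambda>y. \<chi> (comm x y))"
  using assms by (auto simp: lin_char_def comm_one_right comm_mult_right comm_in_derived subset_iff)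

text \<open>By bilinearity the value of \<chi> at \<open>comm (r \<otimes> inv s) q\<close> is the
  quotient of the two given values, hence 1; \<chi> has trivial kernel on \<open>D\<close>.\<close>

lemma comm_separates:
  assumes \<chi>: "lin_char G D \<chi>" and ker: "\<And>x. x \<in> D \<Longrightarrow> \<chi> x = 1 \<Longrightarrow> x = \<one>"
    and G: "r \<in> carrier G" "s \<in> carrier G" "q \<in> carrier G"
    and eq: "\<chi> (comm r q) = \<chi> (comm s q)"
  shows "comm (r \<otimes> inv s) q = \<one>"
proof (rule ker)
  have "comm r q = comm (r \<otimes> inv s) q \<otimes> comm s q"
    using G comm_mult_left[of "r \<otimes> inv s" s q] by (simp add: m_assoc)
  then have "\<chi> (comm r q) = \<chi> (comm (r \<otimes> inv s) q) * \<chi> (comm s q)"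
    using lin_char_mult[OF \<chi>] comm_in_derived G by simp
  moreover have "\<chi> (comm s q) \<noteq> 0"
    using lin_char_nonzero[OF \<chi> subgroup_derived] comm_in_derived G by blast
  ultimately show "\<chi> (comm (r \<otimes> inv s) q) = 1" using eq by simp
qed (use comm_in_derived G in auto)

text \<open>Each \<open>x\<close> in \<open>P\<close> gives the character
  \<open>\<chi> (comm x q)\<close> of \<open>q\<close> in \<open>Q\<close>, trivial on
  \<open>L\<close>. By nondegeneracy distinct cosets of \<open>N\<close> in \<open>P\<close> give
  distinct characters, so [P:N] is at most [Q:L].\<close>

lemma index_le:
  assumes \<chi>: "lin_char G D \<chi>" and ker: "\<And>x. x \<in> D \<Longrightarrow> \<chi> x = 1 \<Longrightarrow> x = \<one>"
    and P: "subgroup P G" and N: "subgroup N G" "N \<subseteq> P"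
    and Q: "subgroup Q G" and L: "subgroup L G" "L \<subseteq> Q"
    and nondeg: "\<And>x. x \<in> P \<Longrightarrow> \<forall>q\<in>Q. comm x q = \<one> \<Longrightarrow> x \<in> N"
    and triv: "\<And>x l. x \<in> P \<Longrightarrow> l \<in> L \<Longrightarrow> comm x l = \<one>"
  shows "card P * card L \<le> card Q * card N"
proof -
  obtain R where R: "R \<subseteq> P" "card R * card N = card P"
    "\<forall>r\<in>R. \<forall>s\<in>R. r \<otimes> inv s \<in> N \<longrightarrow> r = s"
    using right_transversal[OF fin P N] by blast
  have RG: "r \<in> carrier G" if "r \<in> R" for r
    using that R(1) subgroup.mem_carrier[OF P] by blast
  have QG: "q \<in> carrier G" if "q \<in> Q" for q
    using that subgroup.mem_carrier[OF Q] by blast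
  have "card R * card L \<le> card Q"
  proof (rule card_lin_chars_le[OF fin Q L, of R "\<lambda>r q. \<chi> (comm r q)"])
    show "finite R"
      using R(1) P fin by (meson finite_subset subgroup.subset)
    show "lin_char G Q (\<lambda>q. \<chi> (comm r q))" if "r \<in> R" for r
      using lin_char_comm[OF \<chi> RG[OF that] subgroup.subset[OF Q]] .
    show "\<chi> (comm r l) = 1" if "r \<in> R" "l \<in> L" for r l
      using triv[of r l] that R(1) lin_char_one[OF \<chi>] by auto
    show "\<exists>q\<in>Q. \<chi> (comm r q) \<noteq> \<chi> (comm s q)" if rs: "r \<in> R" "s \<in> R" "r \<noteq> s" for r s
    proof (rule ccontr)
      assume "\<not> ?thesis"
      then have "\<forall>q\<in>Q. comm (r \<otimes> inv s) q = \<one>"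
        using comm_separates[OF \<chi> ker RG[OF rs(1)] RG[OF rs(2)] QG] by blast
      moreover have "r \<otimes> inv s \<in> P"
        using rs R(1) P by (meson subgroup.m_closed subgroup.m_inv_closed subsetD)
      ultimately have "r \<otimes> inv s \<in> N" using nondeg by blast
      then show False using R(3) rs by blast
    qed
  qed
  then have "card R * card L * card N \<le> card Q * card N" by (rule mult_le_mono1)
  moreover have "card R * card L * card N = card P * card L" by (simp flip: R(2))
  ultimately show ?thesis by simp
qed

section \<open>Characters of the cyclic commutator subgroup\<close>

lemma derived_generator: "\<exists>y\<in>D. \<forall>x\<in>D. \<exists>k::nat. x = y [^] k"
proof -
  interpret S: group "subgroup_generated G D" by simp
  have carr: "carrier (subgroup_generated G D) = D"
    using subgroup.carrier_subgroup_generated_subgroup[OF subgroup_derived] .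
  obtain y where y: "y \<in> D" "D = range (\<lambda>n::int. y [^]\<^bsub>subgroup_generated G D\<^esub> n)"
    using derived_cyclic S.cyclic_group carr by auto
  have yG: "y \<in> carrier G" using subgroup.mem_carrier[OF subgroup_derived y(1)] .
  have "\<exists>k::nat. x = y [^] k" if x: "x \<in> D" for x
  proof -
    have pow: "y [^]\<^bsub>subgroup_generated G D\<^esub> n = y [^] n" for n :: int
      using int_pow_subgroup_generated[of y D n] y(1) carr by simp
    obtain n :: int where n: "x = y [^] n" using x y(2) unfolding pow by blast
    have o: "order G > 0" "y [^] order G = \<one>"
      using fin yG by (auto simp: order_gt_0_iff_finite pow_order_eq_1)
    \<comment> \<open>Reducing modulo the group order turns the integer exponent into a natural
      one.\<close>
    have "x = y [^] (n mod int (order G))"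
    proof -
      have "y [^] n = y [^] (int (order G) * (n div int (order G)) + n mod int (order G))" by simp
      also have "\<dots> = (y [^] int (order G)) [^] (n div int (order G)) \<otimes> y [^] (n mod int (order G))"
        using yG by (simp only: int_pow_mult int_pow_pow)
      also have "y [^] int (order G) = \<one>" using o(2) by (simp add: int_pow_int)
      finally show ?thesis using yG n by simp
    qed
    moreover have "n mod int (order G) \<ge> 0" using o(1) by simp
    ultimately have "x = y [^] nat (n mod int (order G))"
      by (metis int_nat_eq int_pow_int)
    then show ?thesis by blast
  qed
  then show ?thesis using y(1) by blast
qed

text \<open>The witness generates the unique subgroup of order p of the cyclic p-group \<open>D\<close>, which is
  contained in every nontrivial kernel.\<close>

lemma ex_socle_element:
  assumes "D \<noteq> {\<one>}"
  shows "\<exists>c\<in>D. c \<noteq> \<one> \<and> (\<forall>\<chi>. lin_char G D \<chi> \<longrightarrow> \<chi> c \<noteq> 1 \<longrightarrow> (\<forall>x\<in>D. \<chi> x = 1 \<longrightarrow> x = \<one>))"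
proof -
  obtain y where y: "y \<in> D" "\<forall>x\<in>D. \<exists>k::nat. x = y [^] k"
    using derived_generator by blast
  have yG: "y \<in> carrier G" using subgroup.mem_carrier[OF subgroup_derived y(1)] .
  obtain m where "card (carrier G) = p ^ m" using p_group by blast
  then have "ord y dvd p ^ m"
    using ord_dvd_group_order[OF yG] by (simp add: order_def)
  then obtain e where e: "ord y = p ^ e"
    using divides_primepow_nat[OF prime] by blast
  have "y \<noteq> \<one>"
  proof
    assume "y = \<one>"
    then have "D \<subseteq> {\<one>}" using y(2) by auto
    then show False using assms y(1) by blast
  qed
  then have "ord y \<noteq> 1" using yG pow_eq_id[OF yG, of 1] by auto
  then obtain f where f: "e = Suc f" using e by (cases e) auto
  \<comment> \<open>Since \<open>y\<close> has order \<open>p ^ Suc f\<close>, this element has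
    order \<open>p\<close>.\<close>
  define c where "c = y [^] (p ^ f)"
  have p1: "p > 1" using prime prime_gt_1_nat by blast
  have "c \<in> D" unfolding c_def using subgroup_nat_pow_closed[OF subgroup_derived y(1)] .
  moreover have "c \<noteq> \<one>"
  proof
    assume "c = \<one>"
    then have "p ^ e dvd p ^ f" using pow_eq_id[OF yG] e by (simp add: c_def)
    then show False using f p1 by (simp add: dvd_power_iff_le)
  qed
  moreover have "x = \<one>" if \<chi>: "lin_char G D \<chi>" "\<chi> c \<noteq> 1" and x: "x \<in> D" "\<chi> x = 1" for \<chi> x
  proof (rule ccontr)
    assume "x \<noteq> \<one>"
    obtain k :: nat where k: "x = y [^] k" using x(1) y(2) by blast
    have pow: "\<chi> (y [^] n) = \<chi> y ^ n" for n :: nat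
      using lin_char_pow[OF \<chi>(1) subgroup_derived y(1)] .
    have "\<not> p ^ e dvd k" using \<open>x \<noteq> \<one>\<close> pow_eq_id[OF yG] e k by simp
    \<comment> \<open>If \<chi> is 1 at \<open>y [^] k\<close>, Bezout makes it 1 at
      \<open>y [^] (p ^ i)\<close>, where \<open>p ^ i\<close> is the gcd. As
      \<open>i \<le> f\<close>, the element \<open>c\<close> is a power of that one, so \<chi> would
      be 1 at \<open>c\<close>.\<close>
    have "gcd (p ^ e) k dvd p ^ e" by simp
    then obtain i where i: "gcd (p ^ e) k = p ^ i" "i \<le> e"
      using divides_primepow_nat[OF prime] by blast
    have "i \<noteq> e"
      using i \<open>\<not> p ^ e dvd k\<close> by (metis gcd_dvd2)
    then have "i \<le> f" using i(2) f by simp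
    have "p ^ e \<noteq> 0" using p1 by simp
    then obtain a b where ab: "p ^ e * a = k * b + gcd (p ^ e) k"
      using bezout_nat[of "p ^ e" k] by blast
    have "\<chi> y ^ (p ^ e) = 1"
      using pow[of "p ^ e"] pow_ord_eq_1[OF yG] e lin_char_one[OF \<chi>(1)] by simp
    then have "1 = \<chi> y ^ (k * b + p ^ i)"
      using ab i(1) by (metis power_mult power_one)
    also have "\<dots> = \<chi> y ^ (p ^ i)"
      using pow[of k] x(2) k by (simp add: power_add power_mult)
    finally have "\<chi> y ^ (p ^ i) = 1" by simp
    moreover have "p ^ f = p ^ i * p ^ (f - i)"
      using \<open>i \<le> f\<close> by (simp flip: power_add)
    ultimately have "\<chi> c = 1" unfolding c_def pow by (simp add: power_mult)
    then show False using \<chi>(2) by blast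
  qed
  ultimately show ?thesis by blast
qed

text \<open>With trivial kernel on \<open>D\<close>, the character \<open>\<chi>0\<close> sends the
  generator \<open>y\<close> to a primitive root of unity of order \<open>q = ord y\<close>. The
  value of \<chi> at \<open>y\<close> is a \<open>q\<close>-th root of unity, so its inverse is a
  power of \<open>\<chi>0 y\<close>.\<close>

lemma ex_twist:
  assumes \<chi>0: "lin_char G D \<chi>0" and ker: "\<And>x. x \<in> D \<Longrightarrow> \<chi>0 x = 1 \<Longrightarrow> x = \<one>"
    and \<chi>: "lin_char G D \<chi>"
  shows "\<exists>k::nat. \<forall>x\<in>D. \<chi> x * \<chi>0 x ^ k = 1"
proof -
  obtain y where y: "y \<in> D" "\<forall>x\<in>D. \<exists>k::nat. x = y [^] k"
    using derived_generator by blast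
  have yG: "y \<in> carrier G" using subgroup.mem_carrier[OF subgroup_derived y(1)] .
  define q where "q = ord y"
  have q: "q > 0" using ord_ge_1[OF fin yG] by (simp add: q_def)
  have pow: "\<theta> (y [^] n) = \<theta> y ^ n" if "lin_char G D \<theta>" for n :: nat and \<theta>
    using lin_char_pow[OF that subgroup_derived y(1)] .
  have root: "\<theta> y ^ q = 1" if "lin_char G D \<theta>" for \<theta>
    using pow[OF that, of q] pow_ord_eq_1[OF yG] lin_char_one[OF that] by (simp add: q_def)
  have nz: "\<theta> y \<noteq> 0" if "lin_char G D \<theta>" for \<theta>
    using lin_char_nonzero[OF that subgroup_derived y(1)] .
  have inj: "inj_on (\<lambda>i. \<chi>0 y ^ i) {..<q}"
  proof (rule linorder_inj_onI')
    fix i j assume ij: "i \<in> {..<q}" "j \<in> {..<q}" "i < j"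
    show "\<chi>0 y ^ i \<noteq> \<chi>0 y ^ j"
    proof
      assume "\<chi>0 y ^ i = \<chi>0 y ^ j"
      also have "\<dots> = \<chi>0 y ^ i * \<chi>0 y ^ (j - i)"
        using ij by (simp flip: power_add)
      finally have "\<chi>0 (y [^] (j - i)) = 1"
        using nz[OF \<chi>0] pow[OF \<chi>0] by simp
      then have "y [^] (j - i) = \<one>"
        using ker subgroup_nat_pow_closed[OF subgroup_derived y(1)] by blast
      then have "q dvd j - i" using pow_eq_id[OF yG] by (simp add: q_def)
      then show False using ij by (auto dest: dvd_imp_le)
    qed
  qed
  \<comment> \<open>There are \<open>q\<close> distinct powers and exactly \<open>q\<close> roots of
    unity.\<close>
  have "(\<lambda>i. \<chi>0 y ^ i) ` {..<q} = {z. z ^ q = 1}"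
  proof (rule card_subset_eq)
    show "finite {z::complex. z ^ q = 1}" using q by (intro finite_roots_unity) simp
    have "(\<chi>0 y ^ i) ^ q = 1" for i
      using root[OF \<chi>0] by (metis power_mult mult.commute power_one)
    then show "(\<lambda>i. \<chi>0 y ^ i) ` {..<q} \<subseteq> {z. z ^ q = 1}" by blast
    show "card ((\<lambda>i. \<chi>0 y ^ i) ` {..<q}) = card {z::complex. z ^ q = 1}"
      using card_image[OF inj] card_roots_unity_eq[OF q] by simp
  qed
  moreover have "inverse (\<chi> y) ^ q = 1" using root[OF \<chi>] by (simp add: power_inverse)
  ultimately obtain k where k: "\<chi>0 y ^ k = inverse (\<chi> y)" by (metis (mono_tags, lifting) imageE mem_Collect_eq)
  have "\<chi> x * \<chi>0 x ^ k = 1" if x: "x \<in> D" for x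
  proof -
    obtain n :: nat where n: "x = y [^] n" using x y(2) by blast
    have "\<chi> x * \<chi>0 x ^ k = (\<chi> y * \<chi>0 y ^ k) ^ n"
      unfolding n pow[OF \<chi>] pow[OF \<chi>0] by (simp add: power_mult_distrib mult.commute flip: power_mult)
    then show ?thesis using k nz[OF \<chi>] by simp
  qed
  then show ?thesis by blast
qed

end

section \<open>The two bounds and the formula\<close>

context cyclic_derived_p_group
begin

text \<open>The \<open>d\<close> conjugates of one weight of \<open>A\<close> collapse to a single
  character on \<open>Z\<close>, so there are at least \<open>d - 1\<close> more weights of
  \<open>A\<close> than restrictions to \<open>Z\<close>. The restrictions together form a faithful
  representation of \<open>Z\<close>.\<close>

lemma faithful_rep_dim_ge:
  assumes D: "D \<noteq> {\<one>}"
    and A: "subgroup A G" and ZA: "Z \<subseteq> A" and A_comm: "\<forall>a\<in>A. \<forall>b\<in>A. a \<otimes> b = b \<otimes> a"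
    and A_max: "\<forall>h\<in>carrier G. (\<forall>a\<in>A. h \<otimes> a = a \<otimes> h) \<longrightarrow> h \<in> A"
    and \<rho>: "mat_rep G (carrier G) n \<rho>" and inj: "inj_on \<rho> (carrier G)"
    and d: "d * card A = order G"
  shows "d + m_faithful (subgroup_generated G Z) \<le> n + 1"
proof -
  have AG: "a \<in> carrier G" if "a \<in> A" for a
    using subgroup.mem_carrier[OF A that] .
  have DA: "D \<subseteq> A" using derived_central ZA by blast
  have \<rho>A: "mat_rep G A n \<rho>"
    using mat_rep_subset[OF \<rho> subgroup.subset[OF A]] .
  have \<rho>1: "x = \<one>" if "x \<in> carrier G" "\<rho> x = 1\<^sub>m n" for x
    using mat_rep_inj_onD[OF \<rho> subgroup_self inj that] .
  define S where "S = weights G A n \<rho>"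
  have S: "finite S" "card S \<le> n"
    using card_weights_le[of G A n \<rho>] by (auto simp: S_def)
  have sep: "\<exists>\<theta>\<in>S. \<theta> a \<noteq> 1" if "a \<in> A" "a \<noteq> \<one>" for a
  proof -
    have "\<rho> a \<noteq> 1\<^sub>m n" using \<rho>1[OF AG[OF that(1)]] that(2) by blast
    then show ?thesis
      unfolding S_def using weights_separate[OF fin A _ \<rho>A that(1)] A_comm by blast
  qed

  obtain c where c: "c \<in> D" "c \<noteq> \<one>"
    "\<forall>\<chi>. lin_char G D \<chi> \<longrightarrow> \<chi> c \<noteq> 1 \<longrightarrow> (\<forall>x\<in>D. \<chi> x = 1 \<longrightarrow> x = \<one>)"
    using ex_socle_element[OF D] by blast
  obtain \<theta>0 where \<theta>0: "\<theta>0 \<in> S" "\<theta>0 c \<noteq> 1"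
    using sep[OF subsetD[OF DA c(1)] c(2)] by blast
  have \<theta>0A: "lin_char G A \<theta>0" using weights_lin_char \<theta>0(1) by (auto simp: S_def)
  have \<theta>0D: "lin_char G D \<theta>0" using lin_char_subset[OF \<theta>0A DA] .
  have ker: "x = \<one>" if "x \<in> D" "\<theta>0 x = 1" for x
    using c(3) \<theta>0D \<theta>0(2) that by blast
  obtain v where v: "v \<noteq> (\<lambda>i. 0)" "\<forall>i\<ge>n. v i = 0"
    "\<forall>a\<in>A. mat_apply n (\<rho> a) v = (\<lambda>i. \<theta>0 a * v i)"
    using \<theta>0(1) unfolding S_def weights_def by blast

  obtain R where R: "R \<subseteq> carrier G" "card R * card A = order G"
    "\<forall>r\<in>R. \<forall>s\<in>R. r \<otimes> inv s \<in> A \<longrightarrow> r = s"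
    using right_transversal[OF fin subgroup_self A subgroup.subset[OF A]] unfolding order_def
    by blast
  have "card A > 0"
    using subgroup.one_closed[OF A] finite_subset[OF subgroup.subset[OF A] fin]
    by (auto simp: card_gt_0_iff)
  then have cardR: "card R = d"
    using R(2) d by (metis mult_right_cancel less_not_refl)
  \<comment> \<open>the conjugate of \<open>\<theta>0\<close> by \<open>r\<close>, with weight vector \<open>\<rho> (inv r) v\<close>\<close>
  define \<Theta> where "\<Theta> = (\<lambda>r. restrict (\<lambda>a. \<theta>0 (comm r a) * \<theta>0 a) A)"
  have \<Theta>S: "\<Theta> r \<in> S" if r: "r \<in> R" for r
  proof -
    have rG: "r \<in> carrier G" using r R(1) by blast
    have "lin_char G A (\<lambda>a. \<theta>0 (comm r a))"
      using lin_char_comm[OF \<theta>0D rG subgroup.subset[OF A]] .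
    then have char: "lin_char G A (\<Theta> r)"
      using \<theta>0A subgroup.m_closed[OF A] subgroup.one_closed[OF A]
      by (simp add: lin_char_def \<Theta>_def)
    define w where "w = mat_apply n (\<rho> (inv r)) v"
    have "mat_apply n (\<rho> r) w = v"
    proof -
      have "mat_apply n (\<rho> r) w = mat_apply n (\<rho> (r \<otimes> inv r)) v"
        using mat_rep_apply_mult[OF \<rho> rG inv_closed[OF rG]] by (simp add: w_def)
      then show ?thesis
        using \<rho> rG mat_apply_one[of n v] v(2) by (simp add: mat_rep_def)
    qed
    then have "w \<noteq> (\<lambda>i. 0)"
      using v(1) linear_op_zero[OF linear_op_mat_apply] by metis
    moreover have "\<forall>i\<ge>n. w i = 0" by (simp add: w_def mat_apply_def)
    moreover have "mat_apply n (\<rho> a) w = (\<lambda>i. \<Theta> r a * w i)" if a: "a \<in> A" for a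
    proof -
      have cA: "comm r a \<in> D" "comm r a \<in> A" using comm_in_derived rG AG a DA by auto
      \<comment> \<open>Moving \<open>a\<close> past \<open>inv r\<close> costs the factor
        \<open>comm r a\<close>, which lies in \<open>A\<close> and acts on \<open>v\<close> by
        \<open>\<theta>0\<close>.\<close>
      have "a \<otimes> inv r = inv r \<otimes> (r \<otimes> a) \<otimes> inv r"
        using rG AG[OF a] by (simp add: m_assoc inv_cancel_left)
      also have "\<dots> = inv r \<otimes> (comm r a \<otimes> a)"
        unfolding mult_eq_comm[OF rG AG[OF a]]
        using rG AG[OF a] comm_closed[OF rG AG[OF a]] by (simp add: m_assoc)
      finally have eq: "a \<otimes> inv r = inv r \<otimes> (comm r a \<otimes> a)" .
      have "mat_apply n (\<rho> a) w = mat_apply n (\<rho> (a \<otimes> inv r)) v"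
        using mat_rep_apply_mult[OF \<rho> AG[OF a] inv_closed[OF rG]] by (simp add: w_def)
      also have "\<dots> = mat_apply n (\<rho> (inv r)) (mat_apply n (\<rho> (comm r a \<otimes> a)) v)"
        unfolding eq using mat_rep_apply_mult[OF \<rho>, of "inv r" "comm r a \<otimes> a"] rG AG[OF a] AG[OF cA(2)]
        by simp
      also have "mat_apply n (\<rho> (comm r a \<otimes> a)) v = (\<lambda>i. \<Theta> r a * v i)"
        using v(3) subgroup.m_closed[OF A cA(2) a] lin_char_mult[OF \<theta>0A cA(2) a] a
        by (simp add: \<Theta>_def)
      also have "mat_apply n (\<rho> (inv r)) (\<lambda>i. \<Theta> r a * v i) = (\<lambda>i. \<Theta> r a * w i)"
        unfolding w_def by (rule linear_op_scale[OF linear_op_mat_apply])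
      finally show ?thesis .
    qed
    moreover have "\<Theta> r \<in> extensional A" by (simp add: \<Theta>_def)
    ultimately show ?thesis
      using char unfolding S_def weights_def by blast
  qed
  have \<Theta>_inj: "inj_on \<Theta> R"
  proof (rule inj_onI)
    fix r s assume rs: "r \<in> R" "s \<in> R" "\<Theta> r = \<Theta> s"
    have G: "r \<in> carrier G" "s \<in> carrier G" using rs R(1) by auto
    have "comm (r \<otimes> inv s) a = \<one>" if a: "a \<in> A" for a
    proof (rule comm_separates[OF \<theta>0D ker G AG[OF a]])
      have "\<theta>0 (comm r a) * \<theta>0 a = \<theta>0 (comm s a) * \<theta>0 a"
        using fun_cong[OF rs(3), of a] a by (simp add: \<Theta>_def)
      then show "\<theta>0 (comm r a) = \<theta>0 (comm s a)"
        using lin_char_nonzero[OF \<theta>0A A a] by simp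
    qed
    then have "\<forall>a\<in>A. (r \<otimes> inv s) \<otimes> a = a \<otimes> (r \<otimes> inv s)"
      using comm_eq_one_iff G AG by simp
    \<comment> \<open>Equal conjugates force \<open>r \<otimes> inv s\<close> to centralize
      \<open>A\<close>, which is its own centralizer.\<close>
    then have "r \<otimes> inv s \<in> A" using A_max G by simp
    then show "r = s" using R(3) rs by blast
  qed
  have \<Theta>_Z: "restrict (\<Theta> r) Z = restrict \<theta>0 Z" if r: "r \<in> R" for r
  proof (rule restrict_ext)
    fix z assume z: "z \<in> Z"
    have "comm r z = \<one>"
      using comm_eq_one_iff[of r z] center_commute[OF z, of r] center_subset[OF z] r R(1) by auto
    then show "\<Theta> r z = \<theta>0 z"
      using z ZA lin_char_one[OF \<theta>0A] by (auto simp: \<Theta>_def)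
  qed

  define Y where "Y = (\<lambda>\<theta>. restrict \<theta> Z) ` S"
  have finY: "finite Y" using S(1) by (simp add: Y_def)
  have "lin_char G Z \<chi>" if \<chi>: "\<chi> \<in> Y" for \<chi>
  proof -
    obtain \<theta> where \<theta>: "\<theta> \<in> S" "\<chi> = restrict \<theta> Z" using \<chi> by (auto simp: Y_def)
    have "lin_char G Z \<theta>"
      using lin_char_subset[OF weights_lin_char ZA] \<theta>(1) unfolding S_def by blast
    then show ?thesis
      using \<theta>(2) subgroup.m_closed[OF subgroup_center] subgroup.one_closed[OF subgroup_center]
      by (simp add: lin_char_def)
  qed
  then obtain \<sigma> where \<sigma>: "mat_rep G Z (card Y) \<sigma>"
    "\<forall>x\<in>Z. \<sigma> x = 1\<^sub>m (card Y) \<longrightarrow> (\<forall>\<chi>\<in>Y. \<chi> x = 1)"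
    using diagonal_rep[OF finY, of G Z "\<lambda>\<chi>. \<chi>"] by blast
  have "inj_on \<sigma> Z"
  proof (rule mat_rep_inj_onI[OF \<sigma>(1) subgroup_center])
    fix z assume z: "z \<in> Z" "\<sigma> z = 1\<^sub>m (card Y)"
    then have "\<forall>\<theta>\<in>S. \<theta> z = 1" using \<sigma>(2) by (auto simp: Y_def)
    then show "z = \<one>" using sep[of z] z(1) ZA by blast
  qed
  then have mY: "m_faithful (subgroup_generated G Z) \<le> card Y"
    using m_faithful_subgroup_le[OF subgroup_center \<sigma>(1)] by blast

  \<comment> \<open>All conjugates restrict to the one deleted character, so the other restrictions
    come from the remaining weights.\<close>
  have "Y - {restrict \<theta>0 Z} \<subseteq> (\<lambda>\<theta>. restrict \<theta> Z) ` (S - \<Theta> ` R)"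
    using \<Theta>_Z by (auto simp: Y_def)
  then have "card (Y - {restrict \<theta>0 Z}) \<le> card (S - \<Theta> ` R)"
    using S(1) by (meson surj_card_le finite_Diff)
  moreover have "card (S - \<Theta> ` R) = card S - d"
    using \<Theta>S card_image[OF \<Theta>_inj] cardR S(1)
    by (subst card_Diff_subset) (auto intro: finite_subset[of _ S])
  moreover have "d \<le> card S"
    using card_mono[OF S(1), of "\<Theta> ` R"] \<Theta>S card_image[OF \<Theta>_inj] cardR by auto
  moreover have "card Y \<le> card (Y - {restrict \<theta>0 Z}) + 1"
    by (subst card_Diff_singleton_if) auto
  ultimately show ?thesis using mY S(2) by linarith
qed

text \<open>Among the weights of a minimal representation of \<open>Z\<close>,
  \<open>\<chi>0\<close> is traded for an induced representation of dimension \<open>d\<close> and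
  each other weight for one character of \<open>G\<close>; this gives dimension
  \<open>d + card S - 1\<close>. The index identity is proved along with it because it rests on the
  same \<open>\<chi>0\<close>.\<close>

lemma ex_faithful_rep_le:
  assumes D: "D \<noteq> {\<one>}"
    and A: "subgroup A G" and ZA: "Z \<subseteq> A" and A_comm: "\<forall>a\<in>A. \<forall>b\<in>A. a \<otimes> b = b \<otimes> a"
    and A_max: "\<forall>h\<in>carrier G. (\<forall>a\<in>A. h \<otimes> a = a \<otimes> h) \<longrightarrow> h \<in> A"
  shows "\<exists>d n \<rho>. d * card A = order G \<and> card A * card A = order G * card Z \<and>
    n + 1 \<le> d + m_faithful (subgroup_generated G Z) \<and>
    mat_rep G (carrier G) n \<rho> \<and> inj_on \<rho> (carrier G)"
proof -
  define m where "m = m_faithful (subgroup_generated G Z)"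
  obtain \<sigma> where \<sigma>: "mat_rep G Z m \<sigma>" "inj_on \<sigma> Z"
    using m_faithful_subgroup_attained[OF fin subgroup_center] by (auto simp: m_def)
  have DZ: "D \<subseteq> Z" by (rule derived_central)
  define S where "S = weights G Z m \<sigma>"
  have S: "finite S" "card S \<le> m"
    using card_weights_le[of G Z m \<sigma>] by (auto simp: S_def)
  have S_char: "lin_char G Z \<chi>" if "\<chi> \<in> S" for \<chi>
    using that weights_lin_char unfolding S_def by blast
  have sep: "\<exists>\<chi>\<in>S. \<chi> z \<noteq> 1" if "z \<in> Z" "z \<noteq> \<one>" for z
  proof -
    have "\<sigma> z \<noteq> 1\<^sub>m m"
      using mat_rep_inj_onD[OF \<sigma>(1) subgroup_center \<sigma>(2) that(1)] that(2) by blast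
    then show ?thesis
      unfolding S_def using weights_separate[OF fin subgroup_center _ \<sigma>(1) that(1)]
        center_commute center_subset by blast
  qed

  obtain c where c: "c \<in> D" "c \<noteq> \<one>"
    "\<forall>\<chi>. lin_char G D \<chi> \<longrightarrow> \<chi> c \<noteq> 1 \<longrightarrow> (\<forall>x\<in>D. \<chi> x = 1 \<longrightarrow> x = \<one>)"
    using ex_socle_element[OF D] by blast
  obtain \<chi>0 where \<chi>0: "\<chi>0 \<in> S" "\<chi>0 c \<noteq> 1"
    using sep[OF subsetD[OF DZ c(1)] c(2)] by blast
  have \<chi>0Z: "lin_char G Z \<chi>0" using S_char \<chi>0(1) .
  have \<chi>0D: "lin_char G D \<chi>0" using lin_char_subset[OF \<chi>0Z DZ] .
  have ker: "x = \<one>" if "x \<in> D" "\<chi>0 x = 1" for x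
    using c(3) \<chi>0D \<chi>0(2) that by blast

  \<comment> \<open>In the commutative subgroup \<open>A\<close> the correction factor for the
    extension is \<one>.\<close>
  have "\<exists>\<psi>. lin_char G A \<psi> \<and> (\<forall>z\<in>Z. \<psi> z = \<chi>0 z)"
  proof (rule lin_char_extend[OF fin A subgroup_center ZA \<chi>0Z])
    fix x y assume "x \<in> A" "y \<in> A"
    then have "x \<otimes> y = y \<otimes> x \<otimes> \<one>"
      using A_comm subgroup.mem_carrier[OF A] by simp
    then show "\<exists>c\<in>Z. \<chi>0 c = 1 \<and> x \<otimes> y = y \<otimes> x \<otimes> c"
      using lin_char_one[OF \<chi>0Z] subgroup.one_closed[OF subgroup_center] by blast
  qed
  then obtain \<theta> where \<theta>: "lin_char G A \<theta>" "\<forall>z\<in>Z. \<theta> z = \<chi>0 z" by blast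
  obtain d \<rho>1 where d: "d * card A = order G" and \<rho>1: "mat_rep G (carrier G) d \<rho>1"
    and \<rho>1_ker: "\<And>g. g \<in> carrier G \<Longrightarrow> \<rho>1 g = 1\<^sub>m d \<Longrightarrow>
      \<exists>r\<in>carrier G. r \<otimes> g \<otimes> inv r \<in> A \<and> \<theta> (r \<otimes> g \<otimes> inv r) = 1"
    using induced_rep[OF fin A \<theta>(1)] by metis

  have "\<exists>\<psi>. lin_char G (carrier G) \<psi> \<and> (\<exists>k::nat. \<forall>z\<in>Z. \<psi> z = \<chi> z * \<chi>0 z ^ k)" if \<chi>: "\<chi> \<in> S" for \<chi>
  proof -
    obtain k :: nat where k: "\<forall>x\<in>D. \<chi> x * \<chi>0 x ^ k = 1"
      using ex_twist[OF \<chi>0D ker lin_char_subset[OF S_char[OF \<chi>] DZ]] by blast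
    \<comment> \<open>The twisted character is 1 on \<open>D\<close>, hence at every commutator,
      which is the condition for extending it to \<open>G\<close>.\<close>
    have "lin_char G Z (\<lambda>z. \<chi> z * \<chi>0 z ^ k)"
      using S_char[OF \<chi>] \<chi>0Z by (simp add: lin_char_def power_mult_distrib mult_ac)
    then have "\<exists>\<psi>. lin_char G (carrier G) \<psi> \<and> (\<forall>z\<in>Z. \<psi> z = \<chi> z * \<chi>0 z ^ k)"
    proof (rule lin_char_extend[OF fin subgroup_self subgroup_center subgroup.subset[OF subgroup_center]])
      fix x y assume xy: "x \<in> carrier G" "y \<in> carrier G"
      have "x \<otimes> y = y \<otimes> x \<otimes> comm x y"
        using mult_eq_comm[OF xy] center_commute[OF comm_in_center[OF xy]] xy by simp
      then show "\<exists>c\<in>Z. \<chi> c * \<chi>0 c ^ k = 1 \<and> x \<otimes> y = y \<otimes> x \<otimes> c"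
        using comm_in_center[OF xy] comm_in_derived[OF xy] k by blast
    qed
    then show ?thesis by blast
  qed
  then have "\<forall>\<chi>\<in>S. \<exists>\<psi>. lin_char G (carrier G) \<psi> \<and> (\<exists>k::nat. \<forall>z\<in>Z. \<psi> z = \<chi> z * \<chi>0 z ^ k)"
    by blast
  from bchoice[OF this] obtain \<psi> where \<psi>: "\<And>\<chi>. \<chi> \<in> S \<Longrightarrow> lin_char G (carrier G) (\<psi> \<chi>)"
    and \<psi>Z: "\<And>\<chi>. \<chi> \<in> S \<Longrightarrow> \<exists>k::nat. \<forall>z\<in>Z. \<psi> \<chi> z = \<chi> z * \<chi>0 z ^ k"
    by blast
  define e where "e = card (S - {\<chi>0})"
  obtain \<rho>2 where \<rho>2: "mat_rep G (carrier G) e \<rho>2"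
    and \<rho>2_ker: "\<forall>x\<in>carrier G. \<rho>2 x = 1\<^sub>m e \<longrightarrow> (\<forall>\<chi>\<in>S - {\<chi>0}. \<psi> \<chi> x = 1)"
    using diagonal_rep[of "S - {\<chi>0}" G "carrier G" \<psi>] S(1) \<psi> unfolding e_def by blast
  define \<rho> where "\<rho> = (\<lambda>x. four_block_mat (\<rho>1 x) (0\<^sub>m d e) (0\<^sub>m e d) (\<rho>2 x))"
  have \<rho>: "mat_rep G (carrier G) (d + e) \<rho>"
    unfolding \<rho>_def by (rule mat_rep_direct_sum[OF \<rho>1 \<rho>2])
  have \<rho>_ker: "\<rho>1 x = 1\<^sub>m d" "\<rho>2 x = 1\<^sub>m e" if x: "x \<in> carrier G" "\<rho> x = 1\<^sub>m (d + e)" for x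
  proof -
    have "\<rho>1 x \<in> carrier_mat d d" "\<rho>2 x \<in> carrier_mat e e"
      using \<rho>1 \<rho>2 x(1) by (auto simp: mat_rep_def)
    then show "\<rho>1 x = 1\<^sub>m d" "\<rho>2 x = 1\<^sub>m e"
      using four_block_diag_eq_one x(2) unfolding \<rho>_def by blast+
  qed
  have faithful_Z: "z = \<one>" if z: "z \<in> Z" "\<rho> z = 1\<^sub>m (d + e)" for z
  proof (rule ccontr)
    assume "z \<noteq> \<one>"
    have zG: "z \<in> carrier G" using center_subset z(1) .
    obtain r where r: "r \<in> carrier G" "\<theta> (r \<otimes> z \<otimes> inv r) = 1"
      using \<rho>1_ker[OF zG \<rho>_ker(1)[OF zG z(2)]] by blast
    have "r \<otimes> z \<otimes> inv r = z"
      using center_commute[OF z(1) r(1)] zG r(1) by (metis inv_closed m_assoc r_inv r_one)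
    then have 1: "\<chi>0 z = 1" using r(2) \<theta>(2) z(1) by simp
    \<comment> \<open>Where \<open>\<chi>0\<close> is 1 the twist is invisible, so the extended
      characters see the original weights.\<close>
    have "\<chi> z = 1" if \<chi>: "\<chi> \<in> S" for \<chi>
    proof (cases "\<chi> = \<chi>0")
      case False
      then have "\<psi> \<chi> z = 1"
        using \<rho>2_ker zG \<rho>_ker(2)[OF zG z(2)] \<chi> by blast
      then show ?thesis using \<psi>Z[OF \<chi>] z(1) 1 by auto
    qed (use 1 in simp)
    then show False using sep[OF z(1) \<open>z \<noteq> \<one>\<close>] by blast
  qed
  have "inj_on \<rho> (carrier G)"
  proof (rule mat_rep_inj_onI[OF \<rho> subgroup_self])
    fix g assume g: "g \<in> carrier G" "\<rho> g = 1\<^sub>m (d + e)"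
    have \<rho>_mult: "\<rho> (x \<otimes> y) = \<rho> x * \<rho> y" if "x \<in> carrier G" "y \<in> carrier G" for x y
      using \<rho> that by (simp add: mat_rep_def)
    have \<rho>_dim: "\<rho> x \<in> carrier_mat (d + e) (d + e)" if "x \<in> carrier G" for x
      using \<rho> that by (simp add: mat_rep_def)
    \<comment> \<open>The kernel contains \<open>comm g h\<close> for each of its elements
      \<open>g\<close>. This commutator is central, so faithfulness on \<open>Z\<close> makes it
      trivial; thus \<open>g\<close> is itself central.\<close>
    have "g \<otimes> h = h \<otimes> g" if h: "h \<in> carrier G" for h
    proof -
      have "\<rho> (g \<otimes> h) = \<rho> h" "\<rho> (h \<otimes> g) = \<rho> h"
        using \<rho>_mult g h \<rho>_dim[OF h] by auto
      then have "\<rho> (comm g h) * \<rho> h = \<rho> h"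
        using mult_eq_comm[OF g(1) h] \<rho>_mult[of "comm g h" "h \<otimes> g"] comm_closed g(1) h by simp
      then have "\<rho> (comm g h) * \<rho> h * \<rho> (inv h) = 1\<^sub>m (d + e)"
        using \<rho>_mult[of h "inv h"] h \<rho> by (simp add: mat_rep_def)
      moreover have "\<rho> (comm g h) * \<rho> h * \<rho> (inv h) = \<rho> (comm g h)"
        using \<rho>_mult comm_closed g(1) h by (metis inv_closed m_assoc m_closed r_inv r_one)
      ultimately have "comm g h = \<one>"
        using faithful_Z comm_in_center g(1) h by simp
      then show ?thesis using comm_eq_one_iff g(1) h by blast
    qed
    then have "g \<in> Z" using g(1) by (simp add: group_center_def)
    then show "g = \<one>" using faithful_Z g(2) by blast
  qed
  moreover have "d + e + 1 \<le> d + m"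
  proof -
    \<comment> \<open>This makes \<open>e\<close> equal to \<open>card S - 1\<close> without
      truncation of the subtraction.\<close>
    have "card S > 0" using \<chi>0(1) S(1) by (auto simp: card_gt_0_iff)
    then show ?thesis using S \<chi>0(1) by (simp add: e_def)
  qed
  moreover have "card A * card A = order G * card Z"
  proof (rule antisym)
    have AG: "a \<in> carrier G" if "a \<in> A" for a
      using subgroup.mem_carrier[OF A that] .
    \<comment> \<open>Pairing \<open>G\<close> modulo \<open>A\<close> with \<open>A\<close> modulo
      \<open>Z\<close>: [G:A] is at most [A:Z], since \<open>A\<close> is its own
      centralizer.\<close>
    have "card (carrier G) * card Z \<le> card A * card A"
    proof (rule index_le[OF \<chi>0D ker subgroup_self A subgroup.subset[OF A] A subgroup_center ZA])
      show "x \<in> A" if "x \<in> carrier G" "\<forall>q\<in>A. comm x q = \<one>" for x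
        using that A_max comm_eq_one_iff AG by blast
      show "comm x l = \<one>" if "x \<in> carrier G" "l \<in> Z" for x l
        using that center_commute center_subset comm_eq_one_iff by metis
    qed
    then show "order G * card Z \<le> card A * card A" by (simp add: order_def)
    \<comment> \<open>The same pairing with the sides exchanged: [A:Z] is at most [G:A], since only
      central elements pair trivially with all of \<open>G\<close>.\<close>
    have "card A * card A \<le> card (carrier G) * card Z"
    proof (rule index_le[OF \<chi>0D ker A subgroup_center ZA subgroup_self A subgroup.subset[OF A]])
      show "x \<in> Z" if "x \<in> A" "\<forall>q\<in>carrier G. comm x q = \<one>" for x
        using that comm_eq_one_iff AG unfolding group_center_def by blast
      show "comm x l = \<one>" if "x \<in> A" "l \<in> A" for x l
        using that A_comm comm_eq_one_iff AG by blast
    qed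
    then show "card A * card A \<le> order G * card Z" by (simp add: order_def)
  qed
  ultimately show ?thesis using d \<rho> unfolding m_def by blast
qed

text \<open>If \<open>D\<close> is trivial, \<open>G\<close> is its own centre and the root is 1.
  Otherwise both bounds, taken for the same \<open>A\<close> and \<open>d\<close>, coincide.\<close>

lemma m_faithful_eq:
  "real (m_faithful G) =
     sqrt (real (card (rcosets Z))) + real (m_faithful (subgroup_generated G Z)) - 1"
proof (cases "D = {\<one>}")
  case True
  have "x \<in> Z" if x: "x \<in> carrier G" for x
  proof -
    have "x \<otimes> y = y \<otimes> x" if "y \<in> carrier G" for y
      using comm_in_derived[OF x that] True comm_eq_one_iff[OF x that] by blast
    then show ?thesis using x by (simp add: group_center_def)
  qed
  then have Z: "Z = carrier G" using center_subset by blast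
  have "card (rcosets Z) * card Z = order G" using lagrange[OF subgroup_center] .
  then have "card (rcosets Z) = 1"
    using Z fin one_closed by (auto simp: order_def)
  moreover have "faithful_rep (subgroup_generated G Z) n \<rho> \<longleftrightarrow> faithful_rep G n \<rho>" for n \<rho>
    unfolding faithful_rep_subgroup_generated[OF subgroup_center] unfolding faithful_rep_iff Z ..
  then have "m_faithful (subgroup_generated G Z) = m_faithful G"
    by (simp add: m_faithful_def)
  ultimately show ?thesis by simp
next
  case False
  obtain A where A: "subgroup A G" "Z \<subseteq> A" "\<forall>a\<in>A. \<forall>b\<in>A. a \<otimes> b = b \<otimes> a"
    "\<forall>h\<in>carrier G. (\<forall>a\<in>A. h \<otimes> a = a \<otimes> h) \<longrightarrow> h \<in> A"
    using ex_maximal_commuting_subgroup[OF fin] by blast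
  obtain d n \<rho> where d: "d * card A = order G" and card_A: "card A * card A = order G * card Z"
    and n: "n + 1 \<le> d + m_faithful (subgroup_generated G Z)"
    and \<rho>: "mat_rep G (carrier G) n \<rho>" "inj_on \<rho> (carrier G)"
    using ex_faithful_rep_le[OF False A] by blast
  have "m_faithful G \<le> n" using m_faithful_le[OF \<rho>] .
  moreover obtain \<tau> where "mat_rep G (carrier G) (m_faithful G) \<tau>" "inj_on \<tau> (carrier G)"
    using m_faithful_attained[OF fin] by blast
  then have "d + m_faithful (subgroup_generated G Z) \<le> m_faithful G + 1"
    using faithful_rep_dim_ge[OF False A _ _ d] by blast
  ultimately have eq: "m_faithful G + 1 = d + m_faithful (subgroup_generated G Z)"
    using n by linarith
  have "card (rcosets Z) = d * d"
  proof -
    have o: "order G > 0" using fin order_gt_0_iff_finite by blast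
    \<comment> \<open>The factor \<open>order G\<close> allows \<open>card A * card A\<close> to be
      replaced by \<open>order G * card Z\<close>; both common factors cancel afterwards.\<close>
    have "card (rcosets Z) * card Z * order G = order G * order G"
      using lagrange[OF subgroup_center] by simp
    also have "\<dots> = d * d * (card A * card A)" by (simp flip: d)
    also have "\<dots> = d * d * card Z * order G" by (simp add: card_A)
    finally have "card (rcosets Z) * card Z = d * d * card Z" using o by simp
    moreover have "card Z > 0"
      using lagrange[OF subgroup_center] o by (metis mult_0_right neq0_conv)
    ultimately show ?thesis by simp
  qed
  then have "sqrt (real (card (rcosets Z))) = real d" by (simp add: real_sqrt_mult)
  moreover have "real (m_faithful G) + 1 = real d + real (m_faithful (subgroup_generated G Z))"
    using eq by (metis of_nat_1 of_nat_add)
  ultimately show ?thesis by simp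
qed

end

theorem theorem1p3:
  fixes H :: "('a, 'b) monoid_scheme" and p :: nat
  assumes "group H"
    and "finite (carrier H)"
    and "Factorial_Ring.prime p"
    and "\<exists>k. card (carrier H) = p ^ k"
    and "derived H (carrier H) \<subseteq> group_center H"
    and "cyclic_group (subgroup_generated H (derived H (carrier H)))"
  shows "real (m_faithful H) =
           sqrt (real (card (rcosets\<^bsub>H\<^esub> (group_center H))))
           + real (m_faithful (subgroup_generated H (group_center H))) - 1"
proof -
  interpret cyclic_derived_p_group H p
    using assms by (simp add: cyclic_derived_p_group_def cyclic_derived_p_group_axioms_def)
  show ?thesis by (rule m_faithful_eq)
qed

end
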